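(* Let $d\ge1$, $0\le\mathfrak a<\mathfrak b$, $\mathfrak c\ge0$, $\beta\ge0$, $\gamma>-1$. For $n\ge0$ let $\operatorname{proj}^{\circ,\mathsf E}_n$ be the orthogonal projection of $L^2(\mathbf W^{\beta,\gamma}_{\mathfrak a,\mathfrak b,\mathfrak c},\Lambda^{d+1}_{\mathfrak a,\mathfrak b,\mathfrak c})$ onto the restrictions to $\Lambda^{d+1}_{\mathfrak a,\mathfrak b,\mathfrak c}$ of $\mathcal V^{\mathsf E}_n(\mathbf W^{\beta,\gamma}_{\mathfrak a,\mathfrak b,\mathfrak c},\mathbb X^{d+1}_{\mathfrak a,\mathfrak b,\mathfrak c})$. If $f\in L^2(\mathbf W^{\beta,\gamma}_{\mathfrak a,\mathfrak b,\mathfrak c},\Lambda^{d+1}_{\mathfrak a,\mathfrak b,\mathfrak c})$, then $f=\sum_{n=0}^\infty\operatorname{proj}^{\circ,\mathsf E}_n f$ in $L^2(\mathbf W^{\beta,\gamma}_{\mathfrak a,\mathfrak b,\mathfrak c},\Lambda^{d+1}_{\mathfrak a,\mathfrak b,\mathfrak c})$.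
   Context: $\mathbb X^{d+1}_{\mathfrak a,\mathfrak b,\mathfrak c}=\{(\mathbf x,t)\in\mathbb R^d\times\mathbb R:\|\mathbf x\|\le1,\ \mathfrak a+(\mathfrak c-\mathfrak a)\|\mathbf x\|^2\le t^2\le\mathfrak b+(\mathfrak c-\mathfrak b)\|\mathbf x\|^2\}$, $\Lambda^{d+1}_{\mathfrak a,\mathfrak b,\mathfrak c}=\{(\mathbf x,t)\in\mathbb X^{d+1}_{\mathfrak a,\mathfrak b,\mathfrak c}:t\ge0\}$, weight $\mathbf W^{\beta,\gamma}_{\mathfrak a,\mathfrak b,\mathfrak c}(\mathbf x,t)=|t|\Big(\frac{-\mathfrak a+(\mathfrak a-\mathfrak c)\|\mathbf x\|^2+t^2}{\mathfrak b-\mathfrak a}\Big)^{\beta-\frac12}\Big(\frac{\mathfrak b-(\mathfrak b-\mathfrak c)\|\mathbf x\|^2-t^2}{\mathfrak b-\mathfrak a}\Big)^\gamma$. $\mathcal V^{\mathsf E}_n(\mathbf W,\mathbb X^{d+1}_{\mathfrak a,\mathfrak b,\mathfrak c})$ is the space of polynomials of degree $n$, even in $t$, orthogonal in $L^2(\mathbf W,\mathbb X^{d+1}_{\mathfrak a,\mathfrak b,\mathfrak c})$ to all polynomials of lower degree. *)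

theory Defs
  imports "HOL-Analysis.Analysis"
begin

text \<open>Points of R^(d+1) are pairs (x, t) with x :: real^'d (d = CARD('d) >= 1) and t :: real.\<close>

definition monom :: "('d::finite \<Rightarrow> nat) \<Rightarrow> nat \<Rightarrow> (real^'d) \<times> real \<Rightarrow> real" where
  "monom \<alpha> k z = (\<Prod>i\<in>UNIV. (fst z $ i) ^ (\<alpha> i)) * (snd z) ^ k"

definition poly_le :: "nat \<Rightarrow> ((real^'d::finite) \<times> real \<Rightarrow> real) set" where
  "poly_le n = {p. \<exists>c :: ('d \<Rightarrow> nat) \<Rightarrow> nat \<Rightarrow> real.
      p = (\<lambda>z. \<Sum>(\<alpha>, k)\<in>{(\<alpha>, k). (\<Sum>i\<in>UNIV. \<alpha> i) + k \<le> n}. c \<alpha> k * monom \<alpha> k z)}"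

definition domX :: "real \<Rightarrow> real \<Rightarrow> real \<Rightarrow> ((real^'d::finite) \<times> real) set" where
  "domX a b c = {z. norm (fst z) \<le> 1 \<and>
      a + (c - a) * (norm (fst z))\<^sup>2 \<le> (snd z)\<^sup>2 \<and>
      (snd z)\<^sup>2 \<le> b + (c - b) * (norm (fst z))\<^sup>2}"

definition domL :: "real \<Rightarrow> real \<Rightarrow> real \<Rightarrow> ((real^'d::finite) \<times> real) set" where
  "domL a b c = {z \<in> domX a b c. snd z \<ge> 0}"

definition wt :: "real \<Rightarrow> real \<Rightarrow> real \<Rightarrow> real \<Rightarrow> real \<Rightarrow> (real^'d::finite) \<times> real \<Rightarrow> real" where
  "wt \<beta> \<gamma> a b c z = \<bar>snd z\<bar>
     * ((- a + (a - c) * (norm (fst z))\<^sup>2 + (snd z)\<^sup>2) / (b - a)) powr (\<beta> - 1/2)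
     * ((b - (b - c) * (norm (fst z))\<^sup>2 - (snd z)\<^sup>2) / (b - a)) powr \<gamma>"

definition wmeas :: "real \<Rightarrow> real \<Rightarrow> real \<Rightarrow> real \<Rightarrow> real \<Rightarrow> ((real^'d::finite) \<times> real) set
    \<Rightarrow> ((real^'d) \<times> real) measure" where
  "wmeas \<beta> \<gamma> a b c S = density lborel (\<lambda>z. ennreal (indicator S z * wt \<beta> \<gamma> a b c z))"

definition VE :: "real \<Rightarrow> real \<Rightarrow> real \<Rightarrow> real \<Rightarrow> real \<Rightarrow> nat \<Rightarrow> ((real^'d::finite) \<times> real \<Rightarrow> real) set" where
  "VE \<beta> \<gamma> a b c n = {p \<in> poly_le n. (\<forall>x t. p (x, - t) = p (x, t)) \<and>
      (\<forall>m<n. \<forall>q\<in>poly_le m.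
         integral\<^sup>L (wmeas \<beta> \<gamma> a b c (domX a b c)) (\<lambda>z. p z * q z) = 0)}"

definition projE :: "real \<Rightarrow> real \<Rightarrow> real \<Rightarrow> real \<Rightarrow> real \<Rightarrow> nat
    \<Rightarrow> ((real^'d::finite) \<times> real \<Rightarrow> real) \<Rightarrow> ((real^'d) \<times> real \<Rightarrow> real)" where
  "projE \<beta> \<gamma> a b c n f = (SOME g. g \<in> VE \<beta> \<gamma> a b c n \<and>
      (\<forall>p\<in>VE \<beta> \<gamma> a b c n.
         integral\<^sup>L (wmeas \<beta> \<gamma> a b c (domL a b c)) (\<lambda>z. (f z - g z) * p z) = 0))"

end

theory Submission
  imports Defs
begin

text \<open>
  The substitution \<open>u = (t\<^sup>2 - A) / (B - A)\<close> on each fibre turns the mass of the weight into a Beta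
  integral times the integral of a power greater than \<open>- 1\<close> of \<open>1 - (norm x)\<^sup>2\<close> over the unit
  ball, so the measure on \<open>domL\<close> is finite. By the symmetry \<open>t \<mapsto> - t\<close>, orthogonality over \<open>domX\<close> of
  polynomials even in \<open>t\<close> is orthogonality over \<open>domL\<close>; thus the partial sums of the expansion are
  the best approximations by even polynomials of bounded degree. On \<open>domL\<close>, where \<open>t \<ge> 0\<close>, the
  functions \<open>x\<^sub>i\<close> and \<open>t\<^sup>2\<close> separate points, so even polynomials are dense by Stone--Weierstrass.
\<close>

section \<open>Square-integrable functions\<close>

text \<open>The integral of squares is only a seminorm on functions, and \<open>projE\<close> picks
  by \<open>SOME\<close> a function satisfying orthogonality relations. The proof therefore stays
  with functions: finite-dimensional linear algebra supplies the existence of projections, and only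
  the relations of the chosen function enter. Since the limit \<open>f\<close> is given in advance,
  best approximation and density yield convergence without completeness of L2. The analytic obstacle
  is finiteness of the mass: \<beta> - 1/2 and \<gamma> may be negative, so the weight may blow up
  on the boundary. The factor |t| is what makes the fibrewise substitution exact; the powers of 1 -
  |x|^2 left over combine to the exponent \<beta> + \<gamma> + 1/2 > -1/2. Finiteness makes
  polynomials square integrable and turns uniform approximation on the compact half domain into L2
  approximation.\<close>

definition square_integrable :: "'a measure \<Rightarrow> ('a \<Rightarrow> real) \<Rightarrow> bool" where
  "square_integrable M f \<longleftrightarrow> f \<in> borel_measurable M \<and> integrable M (\<lambda>z. (f z)\<^sup>2)"

lemma square_integrable_square: "square_integrable M f \<Longrightarrow> integrable M (\<lambda>z. (f z)\<^sup>2)"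
  by (simp add: square_integrable_def)

lemma square_integrable_mult_integrable:
  assumes "square_integrable M f" "square_integrable M g"
  shows "integrable M (\<lambda>z. f z * g z)"
proof (rule Bochner_Integration.integrable_bound)
  have [measurable]: "f \<in> borel_measurable M" "g \<in> borel_measurable M"
    using assms by (simp_all add: square_integrable_def)
  show "integrable M (\<lambda>z. (f z)\<^sup>2 + (g z)\<^sup>2)"
    using assms by (simp add: square_integrable_def)
  show "(\<lambda>z. f z * g z) \<in> borel_measurable M"
    by measurable
  have "\<bar>x * y\<bar> \<le> x\<^sup>2 + y\<^sup>2" for x y :: real
  proof -
    have "0 \<le> (\<bar>x\<bar> - \<bar>y\<bar>)\<^sup>2" by simp
    then have "2 * (\<bar>x\<bar> * \<bar>y\<bar>) \<le> x\<^sup>2 + y\<^sup>2" by (simp add: power2_diff)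
    moreover have "0 \<le> \<bar>x\<bar> * \<bar>y\<bar>" by simp
    ultimately show ?thesis unfolding abs_mult by linarith
  qed
  then show "AE z in M. norm (f z * g z) \<le> norm ((f z)\<^sup>2 + (g z)\<^sup>2)"
    by simp
qed

lemma square_integrable_add:
  assumes "square_integrable M f" "square_integrable M g"
  shows "square_integrable M (\<lambda>z. f z + g z)"
  using assms square_integrable_mult_integrable[OF assms]
  by (auto simp: square_integrable_def power2_sum mult.assoc)

lemma square_integrable_scale:
  assumes "square_integrable M f"
  shows "square_integrable M (\<lambda>z. k * f z)"
  using assms by (auto simp: square_integrable_def power_mult_distrib)

lemma square_integrable_diff:
  assumes "square_integrable M f" "square_integrable M g"
  shows "square_integrable M (\<lambda>z. f z - g z)"
  using square_integrable_add[OF assms(1) square_integrable_scale[OF assms(2), of "-1"]] by simp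

lemma square_integrable_sum:
  assumes "\<And>i. i \<in> I \<Longrightarrow> square_integrable M (f i)"
  shows "square_integrable M (\<lambda>z. \<Sum>i\<in>I. f i z)"
  using assms
  by (induction I rule: infinite_finite_induct)
     (auto intro: square_integrable_add simp: square_integrable_def[of _ "\<lambda>_. 0"])

lemma integral_square_add_le:
  assumes "square_integrable M f" "square_integrable M g"
  shows "(\<integral>z. (f z + g z)\<^sup>2 \<partial>M) \<le> 2 * (\<integral>z. (f z)\<^sup>2 \<partial>M) + 2 * (\<integral>z. (g z)\<^sup>2 \<partial>M)"
proof -
  have "(\<integral>z. (f z + g z)\<^sup>2 \<partial>M) \<le> (\<integral>z. 2 * (f z)\<^sup>2 + 2 * (g z)\<^sup>2 \<partial>M)"
  proof (rule integral_mono)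
    fix z
    have "0 \<le> (f z - g z)\<^sup>2" by simp
    then show "(f z + g z)\<^sup>2 \<le> 2 * (f z)\<^sup>2 + 2 * (g z)\<^sup>2"
      by (simp add: power2_diff power2_sum)
  qed (use assms square_integrable_add[OF assms] in \<open>auto simp: square_integrable_def\<close>)
  then show ?thesis
    using assms by (simp add: square_integrable_def)
qed

section \<open>Orthogonal projection onto the span of a finite family\<close>

lemma orthogonal_if_norm_zero:
  assumes f: "square_integrable M f" and g: "square_integrable M g"
    and g0: "(\<integral>z. (g z)\<^sup>2 \<partial>M) = 0"
  shows "(\<integral>z. f z * g z \<partial>M) = 0"
proof -
  have "AE z in M. (g z)\<^sup>2 = 0"
    using g0 g by (subst (asm) integral_nonneg_eq_0_iff_AE) (auto simp: square_integrable_def)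
  then have "AE z in M. f z * g z = 0" by auto
  then show ?thesis
    by (rule integral_eq_zero_AE)
qed

text \<open>Gram--Schmidt; a vector of norm zero is orthogonal to everything, so no linear
  independence of the family is required.\<close>
lemma exists_projection_finite_span:
  assumes "finite I" and "\<And>i. i \<in> I \<Longrightarrow> square_integrable M (e i)"
    and "square_integrable M f"
  shows "\<exists>c. \<forall>i\<in>I. (\<integral>z. (f z - (\<Sum>j\<in>I. c j * e j z)) * e i z \<partial>M) = 0"
  using assms
proof (induction I arbitrary: f rule: finite_induct)
  case (insert k I)
  have e: "square_integrable M (e i)" if "i \<in> insert k I" for i
    using insert.prems that by auto
  have lin: "square_integrable M (\<lambda>z. \<Sum>j\<in>I. c j * e j z)" for c
    using e by (intro square_integrable_sum square_integrable_scale) auto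
  obtain c where c: "\<forall>i\<in>I. (\<integral>z. (f z - (\<Sum>j\<in>I. c j * e j z)) * e i z \<partial>M) = 0"
    using insert.IH[OF e insert.prems(2)] by auto
  obtain d where d: "\<forall>i\<in>I. (\<integral>z. (e k z - (\<Sum>j\<in>I. d j * e j z)) * e i z \<partial>M) = 0"
    using insert.IH[OF e e[of k]] by auto
  define u where "u z = f z - (\<Sum>j\<in>I. c j * e j z)" for z
  define v where "v z = e k z - (\<Sum>j\<in>I. d j * e j z)" for z
  have u: "square_integrable M u" and v: "square_integrable M v"
    unfolding u_def v_def
    using lin e insert.prems by (auto intro!: square_integrable_diff)
  \<comment> \<open>The Gram-Schmidt coefficient. If \<open>v\<close> has norm zero, division by
    zero gives \<open>s = 0\<close>, which is still correct because then \<open>u\<close> is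
    orthogonal to \<open>v\<close>.\<close>
  define s where "s = (\<integral>z. u z * v z \<partial>M) / (\<integral>z. (v z)\<^sup>2 \<partial>M)"
  have uv: "(\<integral>z. (u z - s * v z) * v z \<partial>M) = 0"
  proof -
    have "(\<integral>z. (u z - s * v z) * v z \<partial>M) = (\<integral>z. u z * v z - s * (v z)\<^sup>2 \<partial>M)"
      by (simp add: algebra_simps power2_eq_square)
    also have "\<dots> = (\<integral>z. u z * v z \<partial>M) - s * (\<integral>z. (v z)\<^sup>2 \<partial>M)"
      using square_integrable_mult_integrable[OF u v] square_integrable_square[OF v] by simp
    also have "\<dots> = 0"
      using orthogonal_if_norm_zero[OF u v] by (auto simp: s_def)
    finally show ?thesis .
  qed
  have w: "square_integrable M (\<lambda>z. u z - s * v z)"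
    by (intro square_integrable_diff square_integrable_scale u v)
  have wI: "(\<integral>z. (u z - s * v z) * e i z \<partial>M) = 0" if "i \<in> I" for i
  proof -
    have "(\<integral>z. (u z - s * v z) * e i z \<partial>M) = (\<integral>z. u z * e i z - s * (v z * e i z) \<partial>M)"
      by (simp add: algebra_simps)
    also have "\<dots> = (\<integral>z. u z * e i z \<partial>M) - s * (\<integral>z. v z * e i z \<partial>M)"
      using square_integrable_mult_integrable[OF u e[of i]] square_integrable_mult_integrable[OF v e[of i]] that
      by simp
    also have "\<dots> = 0"
      using c d that by (simp add: u_def v_def)
    finally show ?thesis .
  qed
  \<comment> \<open>\<open>e k\<close> is \<open>v\<close> plus a combination of the
    \<open>e j\<close> with \<open>j\<close> in \<open>I\<close>, and \<open>u - s * v\<close> is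
    orthogonal to each of these.\<close>
  have wk: "(\<integral>z. (u z - s * v z) * e k z \<partial>M) = 0"
  proof -
    have "(\<integral>z. (u z - s * v z) * e k z \<partial>M) =
        (\<integral>z. (u z - s * v z) * v z + (\<Sum>j\<in>I. d j * ((u z - s * v z) * e j z)) \<partial>M)"
    proof (rule Bochner_Integration.integral_cong)
      fix z
      have "e k z = v z + (\<Sum>j\<in>I. d j * e j z)" by (simp add: v_def)
      then have "(u z - s * v z) * e k z =
          (u z - s * v z) * v z + (u z - s * v z) * (\<Sum>j\<in>I. d j * e j z)"
        by (simp only: distrib_left)
      then show "(u z - s * v z) * e k z =
          (u z - s * v z) * v z + (\<Sum>j\<in>I. d j * ((u z - s * v z) * e j z))"
        by (simp add: sum_distrib_left mult.left_commute)
    qed simp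
    also have "\<dots> = (\<integral>z. (u z - s * v z) * v z \<partial>M) +
        (\<Sum>j\<in>I. d j * (\<integral>z. (u z - s * v z) * e j z \<partial>M))"
      using square_integrable_mult_integrable[OF w v] square_integrable_mult_integrable[OF w e]
      by (subst Bochner_Integration.integral_add) auto
    finally show ?thesis using uv wI by simp
  qed
  \<comment> \<open>Coefficients read off from expanding \<open>u - s * v\<close> in terms of
    \<open>f\<close>, \<open>e k\<close> and the \<open>e j\<close>.\<close>
  define h where "h j = (if j = k then s else c j - s * d j)" for j
  have h: "f z - (\<Sum>j\<in>insert k I. h j * e j z) = u z - s * v z" for z
  proof -
    have "(\<Sum>j\<in>I. h j * e j z) = (\<Sum>j\<in>I. c j * e j z - s * (d j * e j z))"
      using insert.hyps by (intro sum.cong) (auto simp: h_def algebra_simps)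
    then show ?thesis
      using insert.hyps by (simp add: h_def u_def v_def sum_subtractf sum_distrib_left algebra_simps)
  qed
  show ?case
    using wI wk by (intro exI[of _ h]) (simp add: h)
qed simp

text \<open>Membership in the L2 closure of \<open>P\<close>. Square integrability is part of it
  because the integral of a non-integrable function is 0, which would make the second conjunct
  meaningless; for the approximants it comes from assumptions on \<open>P\<close>.\<close>

definition L2_approximable :: "'a measure \<Rightarrow> (('a \<Rightarrow> real) \<Rightarrow> bool) \<Rightarrow> ('a \<Rightarrow> real) \<Rightarrow> bool" where
  "L2_approximable M P f \<longleftrightarrow> square_integrable M f \<and>
     (\<forall>e>0. \<exists>g. P g \<and> (\<integral>z. (f z - g z)\<^sup>2 \<partial>M) < e)"

lemma L2_approximableD:
  "L2_approximable M P f \<Longrightarrow> 0 < e \<Longrightarrow> \<exists>g. P g \<and> (\<integral>z. (f z - g z)\<^sup>2 \<partial>M) < e"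
  by (simp add: L2_approximable_def)

lemma L2_approximable_limit:
  assumes P: "\<And>g. P g \<Longrightarrow> square_integrable M g"
    and f: "square_integrable M f" and s: "\<And>n. L2_approximable M P (s n)"
    and lim: "(\<lambda>n. \<integral>z. (f z - s n z)\<^sup>2 \<partial>M) \<longlonglongrightarrow> 0"
  shows "L2_approximable M P f"
  unfolding L2_approximable_def
proof (intro conjI f allI impI)
  fix e :: real assume "0 < e"
  \<comment> \<open>The inequality (x + y)^2 \<le> 2 x^2 + 2 y^2 doubles each of the two errors,
    hence the quarter.\<close>
  then have "0 < e / 4" by simp
  then have "eventually (\<lambda>n. (\<integral>z. (f z - s n z)\<^sup>2 \<partial>M) < e / 4) sequentially"
    by (rule order_tendstoD(2)[OF lim])
  then obtain n where n: "(\<integral>z. (f z - s n z)\<^sup>2 \<partial>M) < e / 4"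
    unfolding eventually_sequentially by auto
  obtain g where g: "P g" "(\<integral>z. (s n z - g z)\<^sup>2 \<partial>M) < e / 4"
    using L2_approximableD[OF s \<open>0 < e / 4\<close>] by blast
  have "square_integrable M (s n)" "square_integrable M g"
    using s P g unfolding L2_approximable_def by auto
  then have "(\<integral>z. ((f z - s n z) + (s n z - g z))\<^sup>2 \<partial>M) \<le>
      2 * (\<integral>z. (f z - s n z)\<^sup>2 \<partial>M) + 2 * (\<integral>z. (s n z - g z)\<^sup>2 \<partial>M)"
    by (intro integral_square_add_le square_integrable_diff f)
  then have "(\<integral>z. (f z - g z)\<^sup>2 \<partial>M) < e"
    using n g by simp
  then show "\<exists>g. P g \<and> (\<integral>z. (f z - g z)\<^sup>2 \<partial>M) < e"
    using g by blast
qed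

lemma L2_approximable_dominated_limit:
  assumes P: "\<And>g. P g \<Longrightarrow> square_integrable M g"
    and f: "square_integrable M f" and s: "\<And>n. L2_approximable M P (s n)"
    and lim: "\<And>z. z \<in> space M \<Longrightarrow> (\<lambda>n. s n z) \<longlonglongrightarrow> f z"
    and w: "square_integrable M w" and bd: "\<And>n z. z \<in> space M \<Longrightarrow> \<bar>f z - s n z\<bar> \<le> \<bar>w z\<bar>"
  shows "L2_approximable M P f"
proof (rule L2_approximable_limit[OF P f s])
  have "(\<lambda>n. \<integral>z. (f z - s n z)\<^sup>2 \<partial>M) \<longlonglongrightarrow> (\<integral>z. 0 \<partial>M)"
  proof (rule integral_dominated_convergence[where w="\<lambda>z. (w z)\<^sup>2"])
    show "integrable M (\<lambda>z. (w z)\<^sup>2)"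
      using w by (rule square_integrable_square)
    show "(\<lambda>z. (f z - s n z)\<^sup>2) \<in> borel_measurable M" for n
      using f s[of n] by (auto simp: square_integrable_def L2_approximable_def)
    show "AE z in M. (\<lambda>n. (f z - s n z)\<^sup>2) \<longlonglongrightarrow> 0"
    proof (rule AE_I2)
      fix z assume "z \<in> space M"
      from tendsto_power[OF tendsto_diff[OF tendsto_const lim[OF this]], of "f z" 2]
      show "(\<lambda>n. (f z - s n z)\<^sup>2) \<longlonglongrightarrow> 0" by simp
    qed
    show "AE z in M. norm ((f z - s n z)\<^sup>2) \<le> (w z)\<^sup>2" for n
      using bd by (auto simp: abs_le_square_iff)
  qed simp
  then show "(\<lambda>n. \<integral>z. (f z - s n z)\<^sup>2 \<partial>M) \<longlonglongrightarrow> 0" by simp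
qed

lemma L2_approximable_linear:
  assumes P: "\<And>g. P g \<Longrightarrow> square_integrable M g"
    and Padd: "\<And>f g. P f \<Longrightarrow> P g \<Longrightarrow> P (\<lambda>z. f z + g z)"
    and Pscale: "\<And>k f. P f \<Longrightarrow> P (\<lambda>z. k * f z)"
    and f: "L2_approximable M P f" and g: "L2_approximable M P g"
  shows "L2_approximable M P (\<lambda>z. f z + k * g z)"
  unfolding L2_approximable_def
proof (intro conjI allI impI)
  have fg: "square_integrable M f" "square_integrable M g"
    using f g unfolding L2_approximable_def by auto
  then show "square_integrable M (\<lambda>z. f z + k * g z)"
    by (intro square_integrable_add square_integrable_scale)
  fix e :: real assume e: "0 < e"
  obtain p where p: "P p" "(\<integral>z. (f z - p z)\<^sup>2 \<partial>M) < e / 4"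
    using L2_approximableD[OF f, of "e / 4"] e by auto
  \<comment> \<open>The summand 1 keeps the denominator positive when \<open>k = 0\<close>.\<close>
  have "0 < e / (4 * (k\<^sup>2 + 1))"
    using e by (intro divide_pos_pos) (auto intro: add_nonneg_pos)
  then obtain q where q: "P q" "(\<integral>z. (g z - q z)\<^sup>2 \<partial>M) < e / (4 * (k\<^sup>2 + 1))"
    using L2_approximableD[OF g] by blast
  have k: "0 < k\<^sup>2 + 1" by (auto intro: add_nonneg_pos)
  have "k\<^sup>2 * (\<integral>z. (g z - q z)\<^sup>2 \<partial>M) \<le> (k\<^sup>2 + 1) * (\<integral>z. (g z - q z)\<^sup>2 \<partial>M)"
    by (intro mult_right_mono) auto
  also have "\<dots> < e / 4"
    using q(2) k by (simp add: field_simps)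
  finally have kq: "k\<^sup>2 * (\<integral>z. (g z - q z)\<^sup>2 \<partial>M) < e / 4" .
  have "(\<integral>z. ((f z - p z) + k * (g z - q z))\<^sup>2 \<partial>M) \<le>
      2 * (\<integral>z. (f z - p z)\<^sup>2 \<partial>M) + 2 * (\<integral>z. (k * (g z - q z))\<^sup>2 \<partial>M)"
    using P p q fg
    by (intro integral_square_add_le square_integrable_diff square_integrable_scale) auto
  also have "\<dots> < e"
    using p kq by (simp add: power_mult_distrib)
  finally have "(\<integral>z. ((f z - p z) + k * (g z - q z))\<^sup>2 \<partial>M) < e" .
  then have "(\<integral>z. (f z + k * g z - (p z + k * q z))\<^sup>2 \<partial>M) < e"
    by (simp add: algebra_simps)
  then show "\<exists>h. P h \<and> (\<integral>z. (f z + k * g z - h z)\<^sup>2 \<partial>M) < e"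
    using Padd[OF p(1) Pscale[OF q(1)]] by blast
qed

section \<open>Density in L2 of a separating algebra of continuous functions\<close>

lemma square_integrable_bounded:
  assumes "finite_measure M" and "f \<in> borel_measurable M" and "AE z in M. \<bar>f z\<bar> \<le> B"
  shows "square_integrable M f"
  unfolding square_integrable_def
proof (intro conjI assms(2) finite_measure.integrable_const_bound[OF assms(1), where B="B\<^sup>2"])
  show "AE z in M. norm ((f z)\<^sup>2) \<le> B\<^sup>2"
    using assms(3) by eventually_elim (simp add: abs_le_square_iff[symmetric])
  show "(\<lambda>z. (f z)\<^sup>2) \<in> borel_measurable M"
    using assms(2) by measurable
qed

lemma square_integrable_continuous:
  fixes f :: "'a::{metric_space, second_countable_topology} \<Rightarrow> real"
  assumes "finite_measure M" and M: "sets M = sets borel"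
    and S: "compact S" "AE z in M. z \<in> S" and f: "continuous_on UNIV f"
  shows "square_integrable M f"
proof -
  have "f \<in> borel_measurable M"
    using f M by (metis borel_measurable_continuous_onI measurable_cong_sets)
  moreover have "bounded (f ` S)"
    using f S(1) by (meson compact_continuous_image compact_imp_bounded continuous_on_subset subset_UNIV)
  then obtain B where "\<And>z. z \<in> S \<Longrightarrow> \<bar>f z\<bar> \<le> B"
    unfolding bounded_iff by auto
  then have "AE z in M. \<bar>f z\<bar> \<le> B"
    using S(2) by (auto elim!: eventually_mono)
  ultimately show ?thesis
    using assms(1) by (intro square_integrable_bounded)
qed

text \<open>Uniform approximation on \<open>S\<close> puts all continuous functions into the closure
  of \<open>P\<close>. The closure is linear and stable under dominated limits, so it successively
  absorbs indicators of open sets, indicators of Borel sets, simple functions and finally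
  \<open>f\<close>.\<close>

lemma L2_approximable_Stone_Weierstrass:
  fixes f :: "'a::{metric_space, second_countable_topology} \<Rightarrow> real"
  assumes fin: "finite_measure M" and M: "sets M = sets borel"
    and S: "compact S" "AE z in M. z \<in> S"
    and Pconst: "\<And>k. P (\<lambda>_. k)"
    and Pcont: "\<And>g. P g \<Longrightarrow> continuous_on UNIV g"
    and Padd: "\<And>f g. P f \<Longrightarrow> P g \<Longrightarrow> P (\<lambda>z. f z + g z)"
    and Pmult: "\<And>f g. P f \<Longrightarrow> P g \<Longrightarrow> P (\<lambda>z. f z * g z)"
    and Psep: "\<And>x y. x \<in> S \<Longrightarrow> y \<in> S \<Longrightarrow> x \<noteq> y \<Longrightarrow> \<exists>g. P g \<and> g x \<noteq> g y"
    and f: "square_integrable M f"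
  shows "L2_approximable M P f"
proof -
  interpret finite_measure M by fact
  have sp: "space M = UNIV"
    using M by (metis sets_eq_imp_space_eq space_borel)
  have P: "square_integrable M g" if "P g" for g
    using square_integrable_continuous[OF fin M S Pcont[OF that]] .
  have Pscale: "P (\<lambda>z. k * g z)" if "P g" for k g
    using Pmult[OF Pconst that] .
  have limit: "L2_approximable M P g"
    if "square_integrable M g" "\<And>n. L2_approximable M P (s n)"
      "\<And>z. z \<in> space M \<Longrightarrow> (\<lambda>n. s n z) \<longlonglongrightarrow> g z"
      "square_integrable M w" "\<And>n z. z \<in> space M \<Longrightarrow> \<bar>g z - s n z\<bar> \<le> \<bar>w z\<bar>"
    for g s w
    using P that by (rule L2_approximable_dominated_limit)
  have linear: "L2_approximable M P (\<lambda>z. g z + k * h z)"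
    if "L2_approximable M P g" "L2_approximable M P h" for g h k
    using P Padd Pscale that by (rule L2_approximable_linear)
  have one: "square_integrable M (\<lambda>_. k)" for k
    by (rule square_integrable_continuous[OF fin M S]) simp
  have cont: "L2_approximable M P g" if g: "continuous_on UNIV g" for g
    unfolding L2_approximable_def
  proof (intro conjI allI impI)
    show sg: "square_integrable M g"
      by (rule square_integrable_continuous[OF fin M S g])
    fix e :: real assume e: "0 < e"
    define m where "m = measure M (space M)"
    have m: "0 \<le> m" by (simp add: m_def)
    \<comment> \<open>A uniform error below \<open>r\<close> costs at most
      \<open>r\<^sup>2 * m = e * m / (m + 1) < e\<close>, also when the total mass \<open>m\<close>
      is 0.\<close>
    define r where "r = sqrt (e / (m + 1))"
    have r: "0 < r" "r\<^sup>2 = e / (m + 1)"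
      using e m by (auto simp: r_def)
    obtain p where p: "P p" "\<forall>x\<in>S. \<bar>g x - p x\<bar> < r"
    proof -
      have "\<exists>p. P p \<and> (\<forall>x\<in>S. \<bar>g x - p x\<bar> < r)"
      proof (rule Stone_Weierstrass_HOL[OF S(1), where P=P])
        show "continuous_on S p" if "P p" for p
          using Pcont[OF that] by (rule continuous_on_subset) simp
        show "continuous_on S g"
          using g by (rule continuous_on_subset) simp
      qed (use Pconst Padd Pmult Psep r(1) in auto)
      then show ?thesis using that by blast
    qed
    have "(\<integral>z. (g z - p z)\<^sup>2 \<partial>M) \<le> (\<integral>z. r\<^sup>2 \<partial>M)"
    proof (rule integral_mono_AE)
      show "integrable M (\<lambda>z. (g z - p z)\<^sup>2)"
        using square_integrable_diff[OF sg P[OF p(1)]] by (rule square_integrable_square)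
      show "AE z in M. (g z - p z)\<^sup>2 \<le> r\<^sup>2"
        using S(2)
      proof eventually_elim
        case (elim z)
        then have "\<bar>g z - p z\<bar> \<le> \<bar>r\<bar>" using p(2) r(1) by fastforce
        then show ?case by (simp add: abs_le_square_iff)
      qed
    qed simp
    also have "\<dots> = e * (m / (m + 1))"
      using r(2) by (simp add: m_def)
    also have "\<dots> < e"
      using e m by (simp add: field_simps)
    finally show "\<exists>p. P p \<and> (\<integral>z. (g z - p z)\<^sup>2 \<partial>M) < e"
      using p(1) by blast
  qed
  have ind: "square_integrable M (indicator A)" if "A \<in> sets M" for A
    using that by (intro square_integrable_bounded[where B=1] finite_measure_axioms)
      (auto simp: indicator_def)
  have ind0: "L2_approximable M P (indicator {})"
  proof -
    have "indicator {} = (\<lambda>z::'a. 0::real)" by (simp add: fun_eq_iff)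
    then show ?thesis using cont[of "\<lambda>_. 0", OF continuous_on_const] by metis
  qed
  \<comment> \<open>Dynkin's argument: open sets form an intersection-stable generator, and
    linearity and limits give complements and countable disjoint unions.\<close>
  have indic: "L2_approximable M P (indicator A)" if "A \<in> sigma_sets UNIV {U. open U}" for A
  proof (rule sigma_sets_induct_disjoint[of "{U. open U}" UNIV A "\<lambda>A. L2_approximable M P (indicator A)"])
    show "Int_stable {U::'a set. open U}"
      by (auto simp: Int_stable_def)
    show "A \<in> sigma_sets UNIV {U. open U}" by fact
    fix U :: "'a set" assume "U \<in> {U. open U}"
    then have U: "open U" by simp
    show "L2_approximable M P (indicator U)"
    proof (cases "U = UNIV")
      \<comment> \<open>The cutoffs \<open>min 1 (real n * infdist z (- U))\<close> used below tend
        to the indicator of a proper open set. For the whole space they would all vanish, since the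
        distance to the empty set is 0 by convention.\<close>
      case True
      then show ?thesis using cont[of "\<lambda>_. 1"] by (simp add: indicator_def)
    next
      case False
      show ?thesis
      proof (rule limit)
        show "square_integrable M (indicator U)"
          using U M by (intro ind) auto
        show "L2_approximable M P (\<lambda>z. min 1 (real n * infdist z (- U)))" for n
          by (intro cont continuous_intros)
        show "(\<lambda>n. min 1 (real n * infdist z (- U))) \<longlonglongrightarrow> indicator U z" for z
        proof (cases "z \<in> U")
          case True
          have "infdist z (- U) \<noteq> 0"
            using in_closed_iff_infdist_zero[of "- U" z] U True False by auto
          then have pos: "0 < infdist z (- U)"
            using infdist_nonneg[of z "- U"] by linarith
          obtain N where N: "1 < real N * infdist z (- U)"
            using reals_Archimedean3[OF pos] by blast
          have "eventually (\<lambda>n. min 1 (real n * infdist z (- U)) = 1) sequentially"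
            using eventually_ge_at_top[of N]
          proof eventually_elim
            case (elim n)
            then have "real N * infdist z (- U) \<le> real n * infdist z (- U)"
              using pos by simp
            then show ?case using N by simp
          qed
          then show ?thesis using True by (simp add: tendsto_eventually)
        qed simp
        show "square_integrable M (\<lambda>_. 1)" by (rule one)
        show "\<bar>indicator U z - min 1 (real n * infdist z (- U))\<bar> \<le> \<bar>1\<bar>" for n z
          using infdist_nonneg[of z "- U"] by (auto simp: indicator_def min_def abs_le_iff)
      qed
    qed
  next
    show "L2_approximable M P (indicator {})"
      by (rule ind0)
  next
    fix A :: "'a set" assume "L2_approximable M P (indicator A)"
    from linear[OF cont[of "\<lambda>_. 1", OF continuous_on_const] this, of "-1"]
    moreover have "(\<lambda>z. 1 + - 1 * indicator A z :: real) = indicator (UNIV - A)"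
      by (auto simp: fun_eq_iff indicator_def)
    ultimately show "L2_approximable M P (indicator (UNIV - A))" by metis
  next
    fix A :: "nat \<Rightarrow> 'a set"
    assume dj: "disjoint_family A" and A: "range A \<subseteq> sigma_sets UNIV {U. open U}"
      and app: "\<And>i. L2_approximable M P (indicator (A i))"
    \<comment> \<open>Disjointness makes the indicator of a finite union the sum of the indicators,
      so linearity applies before the limit is taken.\<close>
    have fin_un: "L2_approximable M P (indicator (\<Union>i<n. A i))" for n
    proof (induction n)
      case 0
      show ?case using ind0 by (simp only: lessThan_0 UN_empty)
    next
      case (Suc n)
      have "A i \<inter> A n = {}" if "i < n" for i
        using dj that by (intro disjoint_family_onD) auto
      then have "(\<Union>i<n. A i) \<inter> A n = {}"
        by auto
      then have "indicator (\<Union>i<Suc n. A i) = (\<lambda>z. indicator (\<Union>i<n. A i) z + 1 * indicator (A n) z :: real)"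
        by (simp add: lessThan_Suc Un_commute[of "A n"] fun_eq_iff indicator_add)
      then show ?case using linear[OF Suc app[of n], of 1] by simp
    qed
    show "L2_approximable M P (indicator (\<Union>i. A i))"
    proof (rule limit[OF _ fin_un])
      have "(\<Union>i. A i) \<in> sigma_sets UNIV {U. open U}"
        using A by (auto intro: sigma_sets.Union)
      then show "square_integrable M (indicator (\<Union>i. A i))"
        using M by (intro ind) (simp add: sets_borel)
      show "(\<lambda>n. indicator (\<Union>i<n. A i) z) \<longlonglongrightarrow> indicator (\<Union>i. A i) z" for z
        by (rule LIMSEQ_indicator_UN)
      show "square_integrable M (\<lambda>_. 1)" by (rule one)
      show "\<bar>indicator (\<Union>i. A i) z - indicator (\<Union>i<n. A i) z\<bar> \<le> \<bar>1::real\<bar>" for n z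
        by (simp split: split_indicator)
    qed
  qed simp
  have simple: "L2_approximable M P s" if s: "simple_function M s" for s
  proof -
    have "finite (s ` space M)" using s by (rule simple_functionD)
    moreover have "L2_approximable M P (\<lambda>z. \<Sum>y\<in>F. y * indicator (s -` {y} \<inter> space M) z)"
      if "finite F" for F
      using that
    proof induction
      case empty
      then show ?case using cont[of "\<lambda>_. 0"] by simp
    next
      case (insert y F)
      have "s -` {y} \<inter> space M \<in> sets M"
        using s by (rule simple_functionD)
      then have "L2_approximable M P (indicator (s -` {y} \<inter> space M))"
        using M by (intro indic) (simp add: sets_borel)
      from linear[OF insert.IH this, of y]
      show ?case by (simp only: sum.insert[OF insert.hyps(1,2)] add.commute)
    qed
    ultimately have app: "L2_approximable M P (\<lambda>z. \<Sum>y\<in>s ` space M. y * indicator (s -` {y} \<inter> space M) z)"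
      by blast
    have eq: "(\<Sum>y\<in>s ` space M. y * indicator (s -` {y} \<inter> space M) z) = s z" for z
    proof -
      have fin: "finite (s ` space M)" using s by (rule simple_functionD)
      have "(\<Sum>y\<in>s ` space M. y * indicator (s -` {y} \<inter> space M) z) =
          (\<Sum>y\<in>s ` space M. if y = s z then y else 0)"
        by (intro sum.cong) (auto simp: indicator_def sp)
      also have "\<dots> = s z" using fin sp by (subst sum.delta) auto
      finally show ?thesis .
    qed
    from app show ?thesis by (simp only: eq)
  qed
  \<comment> \<open>The bound by \<open>2 * norm (f x)\<close> is what makes \<open>3 * f\<close>
    dominate the differences \<open>f - s n\<close>.\<close>
  obtain s where s: "\<And>i. simple_function M (s i)" "\<And>x. x \<in> space M \<Longrightarrow> (\<lambda>i. s i x) \<longlonglongrightarrow> f x"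
    "\<And>i x. x \<in> space M \<Longrightarrow> norm (s i x) \<le> 2 * norm (f x)"
    using borel_measurable_implies_sequence_metric[of f M 0] f
    unfolding square_integrable_def norm_conv_dist by metis
  show ?thesis
  proof (rule limit[OF f simple[OF s(1)] s(2)])
    show "square_integrable M (\<lambda>z. 3 * f z)"
      using f by (rule square_integrable_scale)
    show "\<bar>f z - s n z\<bar> \<le> \<bar>3 * f z\<bar>" if "z \<in> space M" for n z
      using s(3)[OF that, of n] by simp
  qed
qed

section \<open>Orthogonal layers of an increasing sequence of subspaces\<close>

locale L2_filtration =
  fixes M :: "'a measure" and U :: "nat \<Rightarrow> ('a \<Rightarrow> real) set"
  assumes square_integrable_U: "p \<in> U n \<Longrightarrow> square_integrable M p"
    and add_U: "p \<in> U n \<Longrightarrow> q \<in> U n \<Longrightarrow> (\<lambda>z. p z + q z) \<in> U n"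
    and scale_U: "p \<in> U n \<Longrightarrow> (\<lambda>z. k * p z) \<in> U n"
    and mono_U: "m \<le> n \<Longrightarrow> U m \<subseteq> U n"
    and projection_U: "square_integrable M f \<Longrightarrow>
      \<exists>p\<in>U n. \<forall>q\<in>U n. (\<integral>z. (f z - p z) * q z \<partial>M) = 0"
begin

text \<open>The orthogonal complement of \<open>U (n - 1)\<close> in \<open>U n\<close>, with
  \<open>W 0 = U 0\<close>. Quantifying over all \<open>m < n\<close> matches the shape of
  \<open>VE\<close>; by monotonicity only \<open>m = n - 1\<close> matters.\<close>

definition W :: "nat \<Rightarrow> ('a \<Rightarrow> real) set" where
  "W n = {p \<in> U n. \<forall>m<n. \<forall>q\<in>U m. (\<integral>z. p z * q z \<partial>M) = 0}"

lemma diff_U: "p \<in> U n \<Longrightarrow> q \<in> U n \<Longrightarrow> (\<lambda>z. p z - q z) \<in> U n"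
  using add_U[OF _ scale_U[of q n "-1"]] by simp

lemma integral_diff_mult:
  assumes "square_integrable M f" "square_integrable M g" "square_integrable M h"
  shows "(\<integral>z. (f z - g z) * h z \<partial>M) = (\<integral>z. f z * h z \<partial>M) - (\<integral>z. g z * h z \<partial>M)"
  using square_integrable_mult_integrable[OF assms(1,3)] square_integrable_mult_integrable[OF assms(2,3)]
  by (simp add: left_diff_distrib)

text \<open>Here \<open>r\<close> is a projection of \<open>q\<close> onto \<open>U n\<close>, so
  this is the decomposition of \<open>U (Suc n)\<close> into \<open>W (Suc n)\<close> and
  \<open>U n\<close>. It serves both to construct projections onto a layer and to pass from
  orthogonality to the layers to orthogonality to \<open>U\<close>.\<close>

lemma diff_projection_in_W:
  assumes q: "q \<in> U (Suc n)" and r: "r \<in> U n"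
    and orth: "\<And>p. p \<in> U n \<Longrightarrow> (\<integral>z. (q z - r z) * p z \<partial>M) = 0"
  shows "(\<lambda>z. q z - r z) \<in> W (Suc n)"
  unfolding W_def
proof (intro CollectI conjI allI ballI impI)
  show "(\<lambda>z. q z - r z) \<in> U (Suc n)"
    using q r mono_U[of n "Suc n"] by (auto intro: diff_U)
  show "(\<integral>z. (q z - r z) * p z \<partial>M) = 0" if "m < Suc n" "p \<in> U m" for m p
    using that mono_U[of m n] by (intro orth) auto
qed

text \<open>With \<open>\<pi>\<^sub>n\<close> the projection onto \<open>U n\<close>, the projection onto \<open>W (Suc n)\<close> is
  \<open>\<pi>\<^sub>n\<^sub>+\<^sub>1 - \<pi>\<^sub>n\<close>.\<close>
lemma projection_W:
  assumes f: "square_integrable M f"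
  shows "\<exists>g\<in>W n. \<forall>p\<in>W n. (\<integral>z. (f z - g z) * p z \<partial>M) = 0"
proof (cases n)
  case 0
  then show ?thesis using projection_U[OF f, of 0] by (auto simp: W_def)
next
  case (Suc k)
  obtain r where r: "r \<in> U k" "\<And>q. q \<in> U k \<Longrightarrow> (\<integral>z. (f z - r z) * q z \<partial>M) = 0"
    using projection_U[OF f] by blast
  obtain s where s: "s \<in> U n" "\<And>q. q \<in> U n \<Longrightarrow> (\<integral>z. (f z - s z) * q z \<partial>M) = 0"
    using projection_U[OF f] by blast
  note sq = f square_integrable_U[OF r(1)] square_integrable_U[OF s(1)]
  have "(\<lambda>z. s z - r z) \<in> W n"
    unfolding Suc
  proof (rule diff_projection_in_W)
    fix q assume q: "q \<in> U k"
    then have "q \<in> U n" using mono_U[of k n] Suc by auto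
    then show "(\<integral>z. (s z - r z) * q z \<partial>M) = 0"
      using r(2)[OF q] s(2)[OF \<open>q \<in> U n\<close>] square_integrable_U[OF q] sq by (simp add: integral_diff_mult)
  qed (use r s Suc in auto)
  \<comment> \<open>\<open>r\<close> lies in \<open>U k\<close> with \<open>k < n\<close>, so
    \<open>p\<close> is orthogonal to it, and only the defining relation of \<open>s\<close>
    remains.\<close>
  moreover have "(\<integral>z. (f z - (s z - r z)) * p z \<partial>M) = 0" if p: "p \<in> W n" for p
  proof -
    have pU: "p \<in> U n" and "(\<integral>z. p z * r z \<partial>M) = 0"
      using p r(1) Suc by (auto simp: W_def)
    then have "(\<integral>z. r z * p z \<partial>M) = 0" by (simp add: mult.commute)
    then show ?thesis
      using s(2)[OF pU] square_integrable_U[OF pU] sq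
      by (simp add: integral_diff_mult square_integrable_diff)
  qed
  ultimately show ?thesis by (intro bexI[of _ "\<lambda>z. s z - r z"] ballI)
qed

text \<open>The assumptions control each layer separately. Once the residual \<open>f - S N\<close>
  is known to be orthogonal to every \<open>U m\<close> with \<open>m < N\<close>, no element of
  these spaces is closer to \<open>f\<close> than \<open>S N\<close>, and density finishes the
  argument.\<close>

theorem orthogonal_expansion:
  assumes f: "square_integrable M f"
    and g: "\<And>n. g n \<in> W n" "\<And>n p. p \<in> W n \<Longrightarrow> (\<integral>z. (f z - g n z) * p z \<partial>M) = 0"
    and dense: "\<And>e. 0 < e \<Longrightarrow> \<exists>n. \<exists>p\<in>U n. (\<integral>z. (f z - p z)\<^sup>2 \<partial>M) < e"
  shows "(\<lambda>N. \<integral>z. (f z - (\<Sum>n<N. g n z))\<^sup>2 \<partial>M) \<longlonglongrightarrow> 0"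
proof -
  define S where "S N z = (\<Sum>n<N. g n z)" for N z
  have gU: "g n \<in> U n" for n using g(1) by (simp add: W_def)
  \<comment> \<open>\<open>S (Suc N)\<close> sums the indices 0 to \<open>N\<close>, hence it lies
    in \<open>U N\<close>.\<close>
  have SU: "S (Suc N) \<in> U N" for N
  proof (induction N)
    case 0
    then show ?case using gU[of 0] by (simp add: S_def[abs_def])
  next
    case (Suc N)
    then have "S (Suc N) \<in> U (Suc N)" using mono_U[of N "Suc N"] by auto
    from add_U[OF this gU] show ?case by (simp add: S_def[abs_def])
  qed
  have S: "square_integrable M (S N)" for N
    unfolding S_def[abs_def] by (intro square_integrable_sum square_integrable_U[OF gU])
  \<comment> \<open>\<open>W\<close> only states orthogonality to lower levels, so the two orders of
    \<open>n\<close> and \<open>m\<close> are treated separately.\<close>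
  have gg: "(\<integral>z. g n z * p z \<partial>M) = 0" if "p \<in> W m" "n \<noteq> m" for n m p
  proof (cases "n < m")
    case True
    then have "(\<integral>z. p z * g n z \<partial>M) = 0" using that gU by (auto simp: W_def)
    then show ?thesis by (simp add: mult.commute)
  next
    case False
    then have "m < n" using that by simp
    then show ?thesis using that g(1)[of n] by (auto simp: W_def)
  qed
  \<comment> \<open>Distinct layers being orthogonal, \<open>S N\<close> pairs with \<open>p\<close>
    as \<open>g m\<close> does, and \<open>g m\<close> pairs with \<open>p\<close> as
    \<open>f\<close> does.\<close>
  have orthW: "(\<integral>z. (f z - S N z) * p z \<partial>M) = 0" if "m < N" "p \<in> W m" for m N p
  proof -
    have p: "square_integrable M p" using that square_integrable_U by (auto simp: W_def)
    have gp: "integrable M (\<lambda>z. g n z * p z)" for n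
      by (intro square_integrable_mult_integrable square_integrable_U[OF gU] p)
    have "(\<integral>z. S N z * p z \<partial>M) = (\<Sum>n<N. \<integral>z. g n z * p z \<partial>M)"
      using gp by (simp add: S_def sum_distrib_right)
    also have "\<dots> = (\<Sum>n\<in>{m}. \<integral>z. g n z * p z \<partial>M)"
      using that gg by (intro sum.mono_neutral_right) auto
    also have "\<dots> = (\<integral>z. f z * p z \<partial>M)"
      using g(2)[OF that(2)] f p square_integrable_U[OF gU] by (simp add: integral_diff_mult)
    finally show ?thesis using f p S by (simp add: integral_diff_mult)
  qed
  \<comment> \<open>Induction on \<open>m\<close>: splitting off the projection \<open>r\<close> of
    \<open>q\<close> onto \<open>U m\<close> leaves a member of the layer
    \<open>W (Suc m)\<close>.\<close>
  have orthU: "(\<integral>z. (f z - S N z) * q z \<partial>M) = 0" if "m < N" "q \<in> U m" for m N q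
    using that
  proof (induction m arbitrary: q)
    case 0
    then show ?case by (intro orthW[of 0]) (auto simp: W_def)
  next
    case (Suc m)
    have q: "square_integrable M q" using Suc.prems square_integrable_U by blast
    obtain r where r: "r \<in> U m" "\<And>p. p \<in> U m \<Longrightarrow> (\<integral>z. (q z - r z) * p z \<partial>M) = 0"
      using projection_U[OF q] by blast
    have "(\<lambda>z. q z - r z) \<in> W (Suc m)"
      using Suc.prems(2) r by (rule diff_projection_in_W)
    from orthW[OF Suc.prems(1) this]
    have "(\<integral>z. (q z - r z) * (f z - S N z) \<partial>M) = 0" by (simp add: mult.commute)
    moreover have "(\<integral>z. r z * (f z - S N z) \<partial>M) = 0"
      using Suc.IH[OF _ r(1)] Suc.prems by (simp add: mult.commute)
    ultimately have "(\<integral>z. q z * (f z - S N z) \<partial>M) = 0"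
      using q square_integrable_U[OF r(1)] f S by (simp add: integral_diff_mult square_integrable_diff)
    then show ?case by (simp add: mult.commute)
  qed
  \<comment> \<open>Pythagoras: \<open>S N - q\<close> lies in \<open>U (N - 1)\<close>, to which
    the residual is orthogonal.\<close>
  have best: "(\<integral>z. (f z - S N z)\<^sup>2 \<partial>M) \<le> (\<integral>z. (f z - q z)\<^sup>2 \<partial>M)" if "m < N" "q \<in> U m" for m N q
  proof -
    have "0 < N" using that by simp
    then obtain k where N: "N = Suc k" by (cases N) auto
    have "q \<in> U k" using that N mono_U[of m k] by auto
    then have d: "(\<lambda>z. S N z - q z) \<in> U k" using SU[of k] N by (auto intro: diff_U)
    have u: "square_integrable M (\<lambda>z. f z - S N z)" using f S by (rule square_integrable_diff)
    note v = square_integrable_U[OF d]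
    have "(\<integral>z. (f z - q z)\<^sup>2 \<partial>M) =
        (\<integral>z. (f z - S N z)\<^sup>2 + (S N z - q z)\<^sup>2 + 2 * ((f z - S N z) * (S N z - q z)) \<partial>M)"
      by (simp add: power2_eq_square algebra_simps)
    also have "\<dots> = (\<integral>z. (f z - S N z)\<^sup>2 \<partial>M) + (\<integral>z. (S N z - q z)\<^sup>2 \<partial>M)
        + 2 * (\<integral>z. (f z - S N z) * (S N z - q z) \<partial>M)"
      using square_integrable_square[OF u] square_integrable_square[OF v]
        square_integrable_mult_integrable[OF u v]
      by (subst Bochner_Integration.integral_add) auto
    also have "(\<integral>z. (f z - S N z) * (S N z - q z) \<partial>M) = 0"
      using orthU[OF _ d] N by simp
    finally show ?thesis by simp
  qed
  have "(\<lambda>N. \<integral>z. (f z - S N z)\<^sup>2 \<partial>M) \<longlonglongrightarrow> 0"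
  proof (rule order_tendstoI)
    fix e :: real assume "e < 0"
    then show "eventually (\<lambda>N. e < (\<integral>z. (f z - S N z)\<^sup>2 \<partial>M)) sequentially"
      by (intro always_eventually allI less_le_trans[OF _ integral_nonneg_AE]) auto
  next
    fix e :: real assume "0 < e"
    then obtain m q where q: "q \<in> U m" "(\<integral>z. (f z - q z)\<^sup>2 \<partial>M) < e"
      using dense by blast
    show "eventually (\<lambda>N. (\<integral>z. (f z - S N z)\<^sup>2 \<partial>M) < e) sequentially"
      using eventually_gt_at_top[of m]
    proof eventually_elim
      case (elim N)
      show ?case using best[OF elim q(1)] q(2) by linarith
    qed
  qed
  then show ?thesis by (simp add: S_def)
qed

end

section \<open>The weighted measures\<close>

text \<open>Choose \<open>k\<close> with \<open>(1/2) ^ Suc k < x \<le> (1/2) ^ k\<close>; a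
  negative power is decreasing, so its value at the left end bounds it. This replaces a singular
  power by geometric constants on dyadic shells.\<close>

lemma dyadic_powr_bound:
  fixes s x :: real
  assumes s: "s < 0" and x: "0 < x" "x \<le> 1"
  shows "\<exists>k. x \<le> (1/2) ^ k \<and> x powr s \<le> (2 powr - s) ^ Suc k"
proof -
  obtain n where n: "(1/2::real) ^ n < x"
    using real_arch_pow_inv[OF x(1), of "1/2"] by auto
  define m where "m = (LEAST n. (1/2::real) ^ n < x)"
  have m: "(1/2::real) ^ m < x" unfolding m_def by (rule LeastI[of _ n]) (rule n)
  have "m \<noteq> 0" using m x by (metis leD power_0)
  then obtain k where k: "m = Suc k" using not0_implies_Suc by blast
  have "\<not> (1/2::real) ^ k < x"
    using not_less_Least[of k "\<lambda>n. (1/2::real) ^ n < x"] k by (simp add: m_def)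
  moreover have "x powr s \<le> ((1/2) ^ Suc k) powr s"
    using m k s by (intro powr_mono2') auto
  moreover have "((1/2::real) ^ Suc k) powr s = (2 powr - s) ^ Suc k"
    by (simp add: powr_realpow[symmetric] powr_powr powr_minus_divide powr_divide divide_simps mult.commute powr_mult flip: powr_add)
  ultimately show ?thesis by (intro exI[of _ k]) auto
qed

text \<open>For \<open>s \<ge> 0\<close> the integrand is at most 1. For \<open>s < 0\<close> a
  point lies in some shell \<open>R k\<close> of width \<open>(1/2) ^ k\<close> at the sphere on
  which it admits the bound \<open>q ^ Suc k\<close>. The shell has volume of order
  \<open>(1/2) ^ k\<close>, so the integral is bounded by a geometric series of ratio
  \<open>q / 2\<close>.\<close>

lemma nn_integral_ball_radial_powr_finite:
  fixes s :: real
  assumes s: "- 1 < s"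
  shows "(\<integral>\<^sup>+x. ennreal (indicator (ball 0 1) x * (1 - (norm x)\<^sup>2) powr s) \<partial>(lborel :: 'a::euclidean_space measure)) < \<infinity>"
proof (cases "s < 0")
  case False
  have "(\<integral>\<^sup>+x. ennreal (indicator (ball 0 1) x * (1 - (norm x)\<^sup>2) powr s) \<partial>(lborel :: 'a measure))
      \<le> (\<integral>\<^sup>+x. indicator (ball 0 1) x \<partial>(lborel :: 'a measure))"
  proof (intro nn_integral_mono)
    fix x :: 'a
    have "(1 - (norm x)\<^sup>2) powr s \<le> 1" if "norm x < 1"
      using that False by (intro powr_le1) (auto simp: power_le_one)
    then show "ennreal (indicator (ball 0 1) x * (1 - (norm x)\<^sup>2) powr s) \<le> indicator (ball 0 1) x"
      by (auto simp: indicator_def)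
  qed
  also have "\<dots> < \<infinity>" using emeasure_lborel_ball_finite[of "0::'a" 1] by simp
  finally show ?thesis .
next
  case True
  define r :: "nat \<Rightarrow> real" where "r k = (1/2) ^ k" for k
  define R where "R k = cball (0::'a) 1 - ball 0 (1 - r k)" for k
  define q :: real where "q = 2 powr - s"
  have r: "0 < r k" "r k \<le> 1" for k by (auto simp: r_def power_le_one)
  define V where "V = unit_ball_vol (real DIM('a))"
  have V: "0 \<le> V" by (simp add: V_def)
  have R: "emeasure lborel (R k) \<le> ennreal (V * DIM('a) * r k)" for k
  proof -
    have "emeasure lborel (R k) = emeasure lborel (cball (0::'a) 1) - emeasure lborel (ball (0::'a) (1 - r k))"
      unfolding R_def
      using emeasure_lborel_ball_finite[of "0::'a" "1 - r k"] r[of k] by (intro emeasure_Diff) (auto simp: less_top)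
    also have "\<dots> = ennreal (V * (1 - (1 - r k) ^ DIM('a)))"
      using r[of k] V by (simp add: emeasure_cball emeasure_ball V_def ennreal_minus right_diff_distrib)
    also have "\<dots> \<le> ennreal (V * DIM('a) * r k)"
    proof (rule ennreal_leI)
      \<comment> \<open>Bernoulli makes the volume of the shell at most linear in its width.\<close>
      have "1 + real DIM('a) * (- r k) \<le> (1 + - r k) ^ DIM('a)"
        using r[of k] by (intro Bernoulli_inequality) auto
      then have "V * (1 - (1 - r k) ^ DIM('a)) \<le> V * (DIM('a) * r k)"
        using V by (intro mult_left_mono) auto
      then show "V * (1 - (1 - r k) ^ DIM('a)) \<le> V * DIM('a) * r k" by (simp add: mult.assoc)
    qed
    finally show ?thesis .
  qed
  have "(\<integral>\<^sup>+x. ennreal (indicator (ball 0 1) x * (1 - (norm x)\<^sup>2) powr s) \<partial>(lborel :: 'a measure))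
      \<le> (\<integral>\<^sup>+x. (\<Sum>k. ennreal (q ^ Suc k) * indicator (R k) x) \<partial>lborel)"
  proof (intro nn_integral_mono)
    fix x :: 'a
    show "ennreal (indicator (ball 0 1) x * (1 - (norm x)\<^sup>2) powr s)
        \<le> (\<Sum>k. ennreal (q ^ Suc k) * indicator (R k) x)"
    proof (cases "norm x < 1")
      case x: True
      obtain k where k: "1 - norm x \<le> r k" "(1 - norm x) powr s \<le> q ^ Suc k"
        using dyadic_powr_bound[OF True, of "1 - norm x"] x by (auto simp: r_def q_def)
      \<comment> \<open>Hence \<open>1 - norm x \<le> 1 - (norm x)\<^sup>2\<close>, and the negative
        power reverses the inequality.\<close>
      have "(norm x)\<^sup>2 \<le> norm x"
        using x by (simp add: power2_eq_square mult_left_le)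
      then have "(1 - (norm x)\<^sup>2) powr s \<le> (1 - norm x) powr s"
        using x True by (intro powr_mono2') auto
      then have "ennreal (indicator (ball 0 1) x * (1 - (norm x)\<^sup>2) powr s) \<le> ennreal (q ^ Suc k)"
        using k x by (intro ennreal_leI) auto
      also have "\<dots> = ennreal (q ^ Suc k) * indicator (R k) x"
        using k x by (auto simp: R_def)
      also have "\<dots> = (\<Sum>j\<in>{k}. ennreal (q ^ Suc j) * indicator (R j) x)"
        by (subst sum.insert) simp_all
      also have "\<dots> \<le> (\<Sum>k. ennreal (q ^ Suc k) * indicator (R k) x)"
        by (rule sum_le_suminf) auto
      finally show ?thesis .
    qed auto
  qed
  also have "\<dots> = (\<Sum>k. \<integral>\<^sup>+x. ennreal (q ^ Suc k) * indicator (R k) x \<partial>lborel)"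
  proof (rule nn_integral_suminf)
    have [measurable]: "R k \<in> sets borel" for k by (simp add: R_def)
    show "(\<lambda>x. ennreal (q ^ Suc k) * indicator (R k) x) \<in> borel_measurable lborel" for k
      by measurable
  qed
  also have "\<dots> = (\<Sum>k. ennreal (q ^ Suc k) * emeasure lborel (R k))"
    by (intro suminf_cong nn_integral_cmult_indicator) (auto simp: R_def)
  also have "\<dots> \<le> (\<Sum>k. ennreal (q * V * DIM('a) * (q / 2) ^ k))"
  proof (rule suminf_le)
    fix k
    have "ennreal (q ^ Suc k) * emeasure lborel (R k) \<le> ennreal (q ^ Suc k) * ennreal (V * DIM('a) * r k)"
      by (intro mult_left_mono R) simp
    also have "\<dots> = ennreal (q * V * DIM('a) * (q / 2) ^ k)"
      using V by (simp add: ennreal_mult'[symmetric] q_def r_def power_divide algebra_simps)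
    finally show "ennreal (q ^ Suc k) * emeasure lborel (R k) \<le> ennreal (q * V * DIM('a) * (q / 2) ^ k)" .
  qed auto
  also have "\<dots> < \<infinity>"
  proof -
    \<comment> \<open>The ratio \<open>q / 2\<close> is below 1 precisely because
      \<open>s > -1\<close>.\<close>
    have "q < 2 powr 1" unfolding q_def using s by (intro powr_less_mono) auto
    moreover have "0 < q" by (simp add: q_def)
    ultimately have "summable (\<lambda>k. q * V * DIM('a) * (q / 2) ^ k)"
      by (intro summable_mult summable_geometric) auto
    then have "(\<Sum>k. ennreal (q * V * DIM('a) * (q / 2) ^ k)) \<noteq> top"
      using V \<open>0 < q\<close> by (subst suminf_ennreal2) auto
    then show ?thesis by (simp add: less_top)
  qed
  finally show ?thesis .
qed

section \<open>The half domain: compactness and total mass\<close>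

lemma closed_domX: "closed (domX a b c)"
  unfolding domX_def by (intro closed_Collect_conj closed_Collect_le continuous_intros)

lemma closed_domL: "closed (domL a b c :: ((real^'d::finite) \<times> real) set)"
proof -
  have "domL a b c = domX a b c \<inter> {z::(real^'d) \<times> real. 0 \<le> snd z}"
    by (auto simp: domL_def)
  then show ?thesis
    by (simp add: closed_domX closed_Int closed_Collect_le continuous_on_snd)
qed

lemma compact_domL: "compact (domL a b c :: ((real^'d::finite) \<times> real) set)"
proof -
  have "\<bar>snd z\<bar> \<le> 1 + \<bar>b\<bar> + \<bar>c\<bar>" if "z \<in> domX a b c" for z :: "(real^'d) \<times> real"
  proof -
    define s where "s = (norm (fst z))\<^sup>2"
    have s: "0 \<le> s" "s \<le> 1" and t: "(snd z)\<^sup>2 \<le> b + (c - b) * s"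
      using that by (auto simp: domX_def s_def power_le_one)
    \<comment> \<open>The upper bound for t^2 is a convex combination of \<open>b\<close> and
      \<open>c\<close>. The added 1 in the radius ensures that its square dominates
      \<open>\<bar>b\<bar> + \<bar>c\<bar>\<close>.\<close>
    have "b + (c - b) * s = b * (1 - s) + c * s" by (simp add: algebra_simps)
    also have "\<dots> \<le> \<bar>b\<bar> * 1 + \<bar>c\<bar> * 1"
      using s by (intro add_mono order_trans[OF mult_right_mono[OF abs_ge_self] mult_left_mono]) auto
    also have "\<dots> \<le> (1 + \<bar>b\<bar> + \<bar>c\<bar>)\<^sup>2" by (simp add: power2_eq_square algebra_simps)
    finally show ?thesis
      using t by (metis abs_ge_zero abs_le_square_iff abs_of_nonneg add_nonneg_nonneg order_trans zero_le_one)
  qed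
  then have "domL a b c \<subseteq> cball (0 :: real^'d) 1 \<times> cball 0 (1 + \<bar>b\<bar> + \<bar>c\<bar>)"
    by (fastforce simp: domL_def domX_def)
  then have "bounded (domL a b c :: ((real^'d) \<times> real) set)"
    by (rule bounded_subset[rotated]) (intro bounded_Times bounded_cball)
  then show ?thesis using closed_domL by (simp add: compact_eq_bounded_closed)
qed

lemma measurable_wt [measurable]: "wt \<beta> \<gamma> a b c \<in> borel_measurable borel"
  unfolding wt_def[abs_def] divide_inverse
  by (intro borel_measurable_times powr_real_measurable borel_measurable_const
      borel_measurable_continuous_onI continuous_intros)

lemma wt_nonneg: "0 \<le> wt \<beta> \<gamma> a b c z"
  by (simp add: wt_def)

lemma measurable_indicator_wt:
  "(\<lambda>z. indicator (domL a b c) z * wt \<beta> \<gamma> a b c z) \<in> borel_measurable borel"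
proof -
  have [measurable]: "domL a b c \<in> sets borel"
    using closed_domL by (rule borel_closed)
  show ?thesis by measurable
qed

text \<open>The substitution \<open>u = (t\<^sup>2 - A) / (B - A)\<close> on the fibre \<open>A \<le> t\<^sup>2 \<le> B\<close> over \<open>x\<close>,
  where \<open>B - A = (b - a) * (1 - (norm x)\<^sup>2)\<close>.\<close>
lemma nn_integral_fibre:
  fixes x :: "real^'d::finite"
  assumes "0 \<le> a" "a < b" "0 \<le> c"
  shows "(\<integral>\<^sup>+t. ennreal (indicator (domL a b c) (x, t) * wt \<beta> \<gamma> a b c (x, t)) \<partial>lborel) =
    ennreal (indicator (ball 0 1) x * (1 - (norm x)\<^sup>2) powr (\<beta> + \<gamma> + 1/2)) *
    (ennreal ((b - a) / 2) *
      (\<integral>\<^sup>+u. ennreal (u powr (\<beta> - 1/2) * (1 - u) powr \<gamma> * indicator {0..1} u) \<partial>lborel))"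
    (is "?l = _ * (_ * ?D)")
proof (cases "norm x < 1")
  case False
  \<comment> \<open>On the unit sphere the fibre forces t^2 = c, and both bases of the powers
    vanish; \<open>0 powr y\<close> is 0 for every exponent, even a negative one.\<close>
  have "indicator (domL a b c) (x, t) * wt \<beta> \<gamma> a b c (x, t) = 0" for t
  proof (cases "norm x = 1")
    case True
    then show ?thesis by (auto simp: indicator_def domL_def domX_def wt_def)
  qed (use False in \<open>simp add: domL_def domX_def\<close>)
  then have "?l = 0" by (simp only: ennreal_0 nn_integral_const mult_zero_left)
  then show ?thesis using False by simp
next
  case True
  define \<rho> where "\<rho> = 1 - (norm x)\<^sup>2"
  define A where "A = a + (c - a) * (norm x)\<^sup>2"
  define B where "B = b + (c - b) * (norm x)\<^sup>2"
  define d where "d = (b - a) * \<rho>"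
  have n2: "(norm x)\<^sup>2 < 1" using True by (simp add: power_less_one_iff abs_square_less_1)
  then have \<rho>: "0 < \<rho>" by (simp add: \<rho>_def)
  have d: "0 < d" "B - A = d"
    using \<rho> assms by (simp add: d_def) (simp add: d_def A_def B_def \<rho>_def algebra_simps)
  \<comment> \<open>Written this way, \<open>a \<ge> 0\<close> and \<open>c \<ge> 0\<close> give
    \<open>A \<ge> 0\<close>, so the fibre is the interval from \<open>sqrt A\<close> to
    \<open>sqrt B\<close>.\<close>
  have "A = a * \<rho> + c * (norm x)\<^sup>2" by (simp add: A_def \<rho>_def algebra_simps)
  then have A: "0 \<le> A" using \<rho> assms by simp
  then have B: "0 < B" using d by simp
  define g where "g t = (t\<^sup>2 - A) / d" for t
  define F where "F u = u powr (\<beta> - 1/2) * (1 - u) powr \<gamma>" for u :: real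
  \<comment> \<open>The two weight factors contribute \<rho> to the power \<beta> + \<gamma> - 1/2.
    Since t dt = (d / 2) du with \<open>d = (b - a) * \<rho>\<close>, the Jacobian adds one more
    \<rho> and the factor \<open>(b - a) / 2\<close>.\<close>
  define K where "K = \<rho> powr (\<beta> + \<gamma> + 1/2) * ((b - a) / 2)"
  have K: "0 \<le> K" using assms by (simp add: K_def)
  have eq: "indicator (domL a b c) (x, t) * wt \<beta> \<gamma> a b c (x, t) =
      K * (F (g t) * (2 * t / d) * indicator {sqrt A..sqrt B} t)" for t
  proof -
    have mem: "(x, t) \<in> domL a b c \<longleftrightarrow> t \<in> {sqrt A..sqrt B}"
    proof (cases "0 \<le> t")
      case t: True
      have "(sqrt A \<le> t) = (A \<le> t\<^sup>2)" using t A by (metis real_sqrt_le_iff real_sqrt_abs abs_of_nonneg)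
      moreover have "(t \<le> sqrt B) = (t\<^sup>2 \<le> B)" using t B by (metis real_sqrt_le_iff real_sqrt_abs abs_of_nonneg)
      ultimately show ?thesis
        using t True by (auto simp: domL_def domX_def A_def B_def)
    next
      case False
      have "0 \<le> sqrt A" using A by simp
      then have "\<not> sqrt A \<le> t" using False by linarith
      then show ?thesis using False by (simp add: domL_def)
    qed
    show ?thesis
    proof (cases "t \<in> {sqrt A..sqrt B}")
      case t: True
      have t0: "0 \<le> t" using t A by (meson atLeastAtMost_iff order_trans real_sqrt_ge_zero)
      have "t\<^sup>2 \<ge> A" using t A by (metis atLeastAtMost_iff sqrt_le_D)
      then have u0: "0 \<le> g t" using d by (simp add: g_def)
      have "t\<^sup>2 \<le> B" using t B t0 by (metis atLeastAtMost_iff less_eq_real_def power_mono real_sqrt_pow2)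
      then have u1: "0 \<le> 1 - g t" using d by (simp add: g_def field_simps)
      have e1: "(- a + (a - c) * (norm x)\<^sup>2 + t\<^sup>2) / (b - a) = \<rho> * g t"
        using d \<rho> assms by (simp add: g_def d_def A_def field_simps)
      have e2: "(b - (b - c) * (norm x)\<^sup>2 - t\<^sup>2) / (b - a) = \<rho> * (1 - g t)"
      proof -
        have "1 - g t = (B - t\<^sup>2) / d"
          using d(1) by (simp add: g_def diff_divide_distrib flip: d(2)) (simp add: field_simps)
        then have "\<rho> * (1 - g t) = (B - t\<^sup>2) / (b - a)"
          using \<rho> assms by (simp add: d_def)
        then show ?thesis by (simp add: B_def algebra_simps)
      qed
      have "wt \<beta> \<gamma> a b c (x, t) = t * (\<rho> * g t) powr (\<beta> - 1/2) * (\<rho> * (1 - g t)) powr \<gamma>"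
        unfolding wt_def fst_conv snd_conv e1 e2 using t0 by simp
      also have "\<dots> = t * (\<rho> powr (\<beta> - 1/2) * \<rho> powr \<gamma>) * F (g t)"
        using \<rho> u0 u1 by (simp add: powr_mult F_def)
      also have "\<rho> powr (\<beta> - 1/2) * \<rho> powr \<gamma> = \<rho> powr (\<beta> + \<gamma> + 1/2) / \<rho>"
      proof -
        have "\<rho> powr (\<beta> - 1/2) * \<rho> powr \<gamma> = \<rho> powr (\<beta> + \<gamma> + 1/2 - 1)"
          by (simp add: powr_add[symmetric] algebra_simps)
        also have "\<dots> = \<rho> powr (\<beta> + \<gamma> + 1/2) / \<rho>"
          using \<rho> by (simp only: powr_diff powr_one)
        finally show ?thesis .
      qed
      also have "t * (\<rho> powr (\<beta> + \<gamma> + 1/2) / \<rho>) * F (g t) = K * (F (g t) * (2 * t / d))"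
        using \<rho> assms by (simp add: K_def d_def field_simps)
      finally show ?thesis using t mem by simp
    qed (use mem in simp)
  qed
  have "?l = (\<integral>\<^sup>+t. ennreal K * ennreal (F (g t) * (2 * t / d) * indicator {sqrt A..sqrt B} t) \<partial>lborel)"
    unfolding eq by (simp only: ennreal_mult'[OF K])
  also have "\<dots> = ennreal K * (\<integral>\<^sup>+t. ennreal (F (g t) * (2 * t / d) * indicator {sqrt A..sqrt B} t) \<partial>lborel)"
    by (rule nn_integral_cmult) (simp add: F_def g_def)
  also have "(\<integral>\<^sup>+t. ennreal (F (g t) * (2 * t / d) * indicator {sqrt A..sqrt B} t) \<partial>lborel) =
      (\<integral>\<^sup>+u. ennreal (F u * indicator {g (sqrt A)..g (sqrt B)} u) \<partial>lborel)"
  proof (rule nn_integral_substitution[symmetric])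
    show "set_borel_measurable borel {g (sqrt A)..g (sqrt B)} F"
      unfolding set_borel_measurable_def F_def by measurable
    show "(g has_real_derivative 2 * t / d) (at t)" for t
      unfolding g_def using d by (auto intro!: derivative_eq_intros)
    show "continuous_on {sqrt A..sqrt B} (\<lambda>t. 2 * t / d)"
      using d by (intro continuous_intros) auto
    show "0 \<le> 2 * t / d" if "t \<in> {sqrt A..sqrt B}" for t
      using that d A by (auto intro!: divide_nonneg_pos intro: order_trans[OF real_sqrt_ge_zero])
    show "sqrt A \<le> sqrt B" using d by simp
  qed
  also have "g (sqrt A) = 0" using A by (simp add: g_def)
  also have "g (sqrt B) = 1" using B d by (simp add: g_def)
  also have "ennreal K = ennreal (indicator (ball 0 1) x * (1 - (norm x)\<^sup>2) powr (\<beta> + \<gamma> + 1/2)) * ennreal ((b - a) / 2)"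
  proof -
    have "ennreal K = ennreal (\<rho> powr (\<beta> + \<gamma> + 1/2)) * ennreal ((b - a) / 2)"
      unfolding K_def by (rule ennreal_mult') simp
    then show ?thesis using True by (simp add: \<rho>_def)
  qed
  finally show ?thesis by (simp add: F_def mult.assoc)
qed

text \<open>Tonelli reduces the mass to the fibre formula. The bounds on \<beta> and \<gamma> enter
  twice: they make the Beta parameters \<beta> + 1/2 and \<gamma> + 1 positive, and the radial
  exponent \<beta> + \<gamma> + 1/2 exceeds -1.\<close>

lemma finite_measure_wmeas_domL:
  assumes "0 \<le> a" "a < b" "0 \<le> c" "0 \<le> \<beta>" "\<gamma> > -1"
  shows "finite_measure (wmeas \<beta> \<gamma> a b c (domL a b c) :: ((real^'d::finite) \<times> real) measure)"
proof
  let ?w = "\<lambda>z::(real^'d) \<times> real. ennreal (indicator (domL a b c) z * wt \<beta> \<gamma> a b c z)"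
  let ?D = "\<integral>\<^sup>+u. ennreal (u powr (\<beta> - 1/2) * (1 - u) powr \<gamma> * indicator {0..1} u) \<partial>lborel"
  have [measurable]: "?w \<in> borel_measurable borel"
    using measurable_indicator_wt by measurable
  have "set_integrable lborel {0..1} (\<lambda>u. u powr (\<beta> + 1/2 - 1) * (1 - u) powr (\<gamma> + 1 - 1))"
    using assms by (intro integrable_Beta) auto
  then have "integrable lborel (\<lambda>u. u powr (\<beta> - 1/2) * (1 - u) powr \<gamma> * indicator {0..1} u)"
    by (simp add: set_integrable_def mult_ac)
  then have "(\<integral>\<^sup>+u. ennreal (norm (u powr (\<beta> - 1/2) * (1 - u) powr \<gamma> * indicator {0..1} u)) \<partial>lborel) < \<infinity>"
    by (simp only: integrable_iff_bounded)
  then have D: "?D < \<infinity>"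
    by (simp add: abs_mult)
  have "emeasure (wmeas \<beta> \<gamma> a b c (domL a b c)) (space (wmeas \<beta> \<gamma> a b c (domL a b c) :: ((real^'d) \<times> real) measure))
      = (\<integral>\<^sup>+z. ?w z \<partial>lborel)"
    unfolding wmeas_def by (simp add: emeasure_density)
  also have "\<dots> = (\<integral>\<^sup>+z. ?w z \<partial>(lborel \<Otimes>\<^sub>M lborel))"
    by (simp add: lborel_prod)
  also have "\<dots> = (\<integral>\<^sup>+x. \<integral>\<^sup>+t. ?w (x, t) \<partial>lborel \<partial>lborel)"
    by (rule lborel.nn_integral_fst[symmetric]) (simp add: lborel_prod)
  also have "\<dots> = (\<integral>\<^sup>+x. ennreal (indicator (ball 0 1) x * (1 - (norm x)\<^sup>2) powr (\<beta> + \<gamma> + 1/2)) *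
      (ennreal ((b - a) / 2) * ?D) \<partial>(lborel :: (real^'d) measure))"
    using assms by (intro nn_integral_cong nn_integral_fibre)
  also have "\<dots> = (\<integral>\<^sup>+x. ennreal (indicator (ball 0 1) x * (1 - (norm x)\<^sup>2) powr (\<beta> + \<gamma> + 1/2))
      \<partial>(lborel :: (real^'d) measure)) * (ennreal ((b - a) / 2) * ?D)"
  proof (rule nn_integral_multc)
    have [measurable]: "ball 0 1 \<in> sets (borel :: (real^'d) measure)" by simp
    show "(\<lambda>x::real^'d. ennreal (indicator (ball 0 1) x * (1 - (norm x)\<^sup>2) powr (\<beta> + \<gamma> + 1/2)))
        \<in> borel_measurable lborel"
      by measurable
  qed
  also have "\<dots> < \<infinity>"
    using nn_integral_ball_radial_powr_finite[where 'a="real^'d", of "\<beta> + \<gamma> + 1/2"] D assms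
    by (auto simp: ennreal_mult_less_top)
  finally show "emeasure (wmeas \<beta> \<gamma> a b c (domL a b c))
      (space (wmeas \<beta> \<gamma> a b c (domL a b c) :: ((real^'d) \<times> real) measure)) \<noteq> \<infinity>"
    by simp
qed

section \<open>Reflection in t and reduction to the half domain\<close>

definition reflect :: "'a \<times> real \<Rightarrow> 'a \<times> real" where
  "reflect z = (fst z, - snd z)"

lemma reflect_simps [simp]:
  "fst (reflect z) = fst z" "snd (reflect z) = - snd z" "reflect (reflect z) = z"
  "reflect (x, t) = (x, - t)"
  by (simp_all add: reflect_def)

lemma continuous_on_reflect [continuous_intros]:
  "continuous_on S (reflect :: 'a::topological_space \<times> real \<Rightarrow> _)"
  unfolding reflect_def[abs_def] by (intro continuous_intros)

lemma measurable_reflect [measurable]: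
  "(reflect :: ('a::second_countable_topology) \<times> real \<Rightarrow> _) \<in> borel \<rightarrow>\<^sub>M borel"
  by (intro borel_measurable_continuous_onI continuous_on_reflect)

lemma distr_lborel_reflect:
  "distr lborel borel reflect = (lborel :: ('a::euclidean_space \<times> real) measure)"
proof -
  have um: "distr lborel lborel uminus = (lborel :: real measure)"
    using lborel_distr_uminus by (simp cong: distr_cong)
  have "distr lborel lborel (\<lambda>x. x) \<Otimes>\<^sub>M distr lborel lborel uminus =
      distr (lborel \<Otimes>\<^sub>M lborel) (lborel \<Otimes>\<^sub>M lborel) (\<lambda>(x::'a, t::real). (x, - t))"
    by (rule pair_measure_distr) (simp_all add: um lborel.sigma_finite_measure_axioms)
  then have "(lborel :: ('a \<times> real) measure) = distr lborel lborel (\<lambda>(x, t). (x, - t))"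
    by (simp add: um lborel_prod distr_id2)
  also have "\<dots> = distr lborel borel reflect"
    by (intro distr_cong) (auto simp: reflect_def)
  finally show ?thesis by simp
qed

text \<open>The full domain is the half domain together with its mirror image. \<open>h\<close> is
  not assumed even because \<open>VE\<close> tests against arbitrary polynomials; integrability of
  both halves allows the integral to be split.\<close>

lemma integral_wmeas_domX:
  fixes h :: "(real^'d::finite) \<times> real \<Rightarrow> real"
  assumes h [measurable]: "h \<in> borel_measurable borel"
    and i1: "integrable (wmeas \<beta> \<gamma> a b c (domL a b c)) h"
    and i2: "integrable (wmeas \<beta> \<gamma> a b c (domL a b c)) (\<lambda>z. h (reflect z))"
  shows "integral\<^sup>L (wmeas \<beta> \<gamma> a b c (domX a b c)) h =
    integral\<^sup>L (wmeas \<beta> \<gamma> a b c (domL a b c)) (\<lambda>z. h z + h (reflect z))"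
proof -
  let ?X = "\<lambda>z::(real^'d) \<times> real. indicator (domX a b c) z * wt \<beta> \<gamma> a b c z"
  let ?L = "\<lambda>z::(real^'d) \<times> real. indicator (domL a b c) z * wt \<beta> \<gamma> a b c z"
  have [measurable]: "domX a b c \<in> sets (borel :: ((real^'d) \<times> real) measure)"
    using closed_domX by (rule borel_closed)
  have L [measurable]: "?L \<in> borel_measurable borel"
    by (rule measurable_indicator_wt)
  \<comment> \<open>The halves overlap only at t = 0, where the factor |t| of the weight vanishes,
    so the identity holds at every point.\<close>
  have split: "?X z = ?L z + ?L (reflect z)" for z
    by (cases "snd z = 0") (auto simp: indicator_def domL_def domX_def wt_def)
  have j1: "integrable lborel (\<lambda>z. ?L z * h z)"
    using i1 unfolding wmeas_def by (subst (asm) integrable_density) (auto simp: wt_nonneg)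
  have j2: "integrable lborel (\<lambda>z. ?L z * h (reflect z))"
    using i2 unfolding wmeas_def by (subst (asm) integrable_density) (auto simp: wt_nonneg)
  \<comment> \<open>Invariance of Lebesgue measure moves the reflection from \<open>h\<close> to the
    density.\<close>
  have j2': "integrable lborel (\<lambda>z. ?L (reflect z) * h z)"
    using j2 by (subst (asm) distr_lborel_reflect[symmetric], subst (asm) integrable_distr_eq) auto
  have "integral\<^sup>L (wmeas \<beta> \<gamma> a b c (domX a b c)) h = (\<integral>z. ?X z * h z \<partial>lborel)"
    unfolding wmeas_def by (subst integral_density) (auto simp: wt_nonneg)
  also have "\<dots> = (\<integral>z. ?L z * h z + ?L (reflect z) * h z \<partial>lborel)"
    by (simp only: split distrib_right)
  also have "\<dots> = (\<integral>z. ?L z * h z \<partial>lborel) + (\<integral>z. ?L (reflect z) * h z \<partial>lborel)"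
    using j1 j2' by (rule Bochner_Integration.integral_add)
  also have "(\<integral>z. ?L (reflect z) * h z \<partial>lborel) =
      (\<integral>z. ?L z * h (reflect z) \<partial>distr lborel borel reflect)"
    by (subst integral_distr) auto
  also have "\<dots> = (\<integral>z. ?L z * h (reflect z) \<partial>lborel)"
    by (simp only: distr_lborel_reflect)
  also have "(\<integral>z. ?L z * h z \<partial>lborel) + \<dots> = (\<integral>z. ?L z * (h z + h (reflect z)) \<partial>lborel)"
    using j1 j2 by (simp add: distrib_left)
  also have "\<dots> = integral\<^sup>L (wmeas \<beta> \<gamma> a b c (domL a b c)) (\<lambda>z. h z + h (reflect z))"
    unfolding wmeas_def by (subst integral_density) (auto simp: wt_nonneg)
  finally show ?thesis .
qed

section \<open>Polynomials even in the last variable\<close>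

definition exponents :: "nat \<Rightarrow> (('d::finite \<Rightarrow> nat) \<times> nat) set" where
  "exponents n = {(\<alpha>, k). (\<Sum>i\<in>UNIV. \<alpha> i) + k \<le> n}"

text \<open>Each \<open>\<alpha> i\<close> is bounded by the total degree. Since sums over infinite
  sets are 0 by convention, finiteness is what gives the sum in \<open>poly_le\<close> its intended
  meaning.\<close>

lemma finite_exponents: "finite (exponents n :: (('d::finite \<Rightarrow> nat) \<times> nat) set)"
proof (rule finite_subset)
  show "exponents n \<subseteq> {\<alpha> :: 'd \<Rightarrow> nat. \<forall>i. (i \<in> UNIV \<longrightarrow> \<alpha> i \<in> {..n}) \<and> (i \<notin> UNIV \<longrightarrow> \<alpha> i = 0)} \<times> {..n}"
  proof -
    have "\<alpha> i \<le> (\<Sum>i\<in>UNIV. \<alpha> i)" for \<alpha> :: "'d \<Rightarrow> nat" and i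
      by (rule member_le_sum) auto
    then have "\<alpha> i \<le> n" if "(\<Sum>i\<in>UNIV. \<alpha> i) \<le> n" for \<alpha> :: "'d \<Rightarrow> nat" and i
      using that by (rule order_trans)
    then show ?thesis by (auto simp: exponents_def)
  qed
  show "finite ({\<alpha> :: 'd \<Rightarrow> nat. \<forall>i. (i \<in> UNIV \<longrightarrow> \<alpha> i \<in> {..n}) \<and> (i \<notin> UNIV \<longrightarrow> \<alpha> i = 0)} \<times> {..n})"
    by (intro finite_cartesian_product finite_set_of_finite_funs) auto
qed

lemma poly_le_iff:
  "p \<in> poly_le n \<longleftrightarrow> (\<exists>c. p = (\<lambda>z. \<Sum>i\<in>exponents n. c i * monom (fst i) (snd i) z))"
proof
  assume "p \<in> poly_le n"
  then obtain c where "p = (\<lambda>z. \<Sum>(\<alpha>, k)\<in>exponents n. c \<alpha> k * monom \<alpha> k z)"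
    by (auto simp: poly_le_def exponents_def)
  then show "\<exists>c. p = (\<lambda>z. \<Sum>i\<in>exponents n. c i * monom (fst i) (snd i) z)"
    by (intro exI[of _ "\<lambda>i. c (fst i) (snd i)"]) (simp add: case_prod_beta)
next
  assume "\<exists>c. p = (\<lambda>z. \<Sum>i\<in>exponents n. c i * monom (fst i) (snd i) z)"
  then obtain c where "p = (\<lambda>z. \<Sum>i\<in>exponents n. c i * monom (fst i) (snd i) z)" by blast
  then show "p \<in> poly_le n"
    unfolding poly_le_def exponents_def
    by (intro CollectI exI[of _ "\<lambda>\<alpha> k. c (\<alpha>, k)"]) (simp add: case_prod_beta)
qed

lemma poly_le_add: "p \<in> poly_le n \<Longrightarrow> q \<in> poly_le n \<Longrightarrow> (\<lambda>z. p z + q z) \<in> poly_le n"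
  unfolding poly_le_iff
proof (elim exE)
  fix c d assume "p = (\<lambda>z. \<Sum>i\<in>exponents n. c i * monom (fst i) (snd i) z)"
    "q = (\<lambda>z. \<Sum>i\<in>exponents n. d i * monom (fst i) (snd i) z)"
  then show "\<exists>c. (\<lambda>z. p z + q z) = (\<lambda>z. \<Sum>i\<in>exponents n. c i * monom (fst i) (snd i) z)"
    by (intro exI[of _ "\<lambda>i. c i + d i"]) (simp add: sum.distrib distrib_right)
qed

lemma poly_le_scale: "p \<in> poly_le n \<Longrightarrow> (\<lambda>z. k * p z) \<in> poly_le n"
  unfolding poly_le_iff
proof (elim exE)
  fix c assume "p = (\<lambda>z. \<Sum>i\<in>exponents n. c i * monom (fst i) (snd i) z)"
  then show "\<exists>c. (\<lambda>z. k * p z) = (\<lambda>z. \<Sum>i\<in>exponents n. c i * monom (fst i) (snd i) z)"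
    by (intro exI[of _ "\<lambda>i. k * c i"]) (simp add: sum_distrib_left mult.assoc)
qed

lemma monom_in_poly_le: "i \<in> exponents n \<Longrightarrow> monom (fst i) (snd i) \<in> poly_le n"
  unfolding poly_le_iff
proof (intro exI[of _ "\<lambda>j. if j = i then 1 else 0"] ext)
  fix z assume i: "i \<in> exponents n"
  have "(\<Sum>j\<in>exponents n. (if j = i then 1 else 0) * monom (fst j) (snd j) z) =
      (\<Sum>j\<in>exponents n. if j = i then monom (fst j) (snd j) z else 0)"
    by (intro sum.cong) auto
  then show "monom (fst i) (snd i) z =
      (\<Sum>j\<in>exponents n. (if j = i then 1 else 0) * monom (fst j) (snd j) z)"
    using i by (simp add: finite_exponents)
qed

lemma zero_in_poly_le: "(\<lambda>_. 0) \<in> poly_le n"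
  unfolding poly_le_iff by (intro exI[of _ "\<lambda>_. 0"]) simp

lemma poly_le_sum: "(\<And>i. i \<in> I \<Longrightarrow> p i \<in> poly_le n) \<Longrightarrow> (\<lambda>z. \<Sum>i\<in>I. p i z) \<in> poly_le n"
  by (induction I rule: infinite_finite_induct) (auto intro: poly_le_add zero_in_poly_le)

lemma poly_le_mono: "m \<le> n \<Longrightarrow> poly_le m \<subseteq> poly_le n"
proof
  fix p :: "(real^'d) \<times> real \<Rightarrow> real" assume mn: "m \<le> n" and "p \<in> poly_le m"
  then obtain c where p: "p = (\<lambda>z. \<Sum>i\<in>exponents m. c i * monom (fst i) (snd i) z)"
    by (auto simp: poly_le_iff)
  show "p \<in> poly_le n"
    unfolding p using mn by (intro poly_le_sum poly_le_scale monom_in_poly_le) (auto simp: exponents_def)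
qed

lemma monom_mult: "monom \<alpha> k z * monom \<alpha>' k' z = monom (\<lambda>i. \<alpha> i + \<alpha>' i) (k + k') z"
  by (simp add: monom_def power_add prod.distrib mult_ac)

lemma poly_le_mult:
  assumes "p \<in> poly_le m" "q \<in> poly_le n"
  shows "(\<lambda>z. p z * q z) \<in> poly_le (m + n)"
proof -
  obtain c d where p: "p = (\<lambda>z. \<Sum>i\<in>exponents m. c i * monom (fst i) (snd i) z)"
    and q: "q = (\<lambda>z. \<Sum>j\<in>exponents n. d j * monom (fst j) (snd j) z)"
    using assms by (auto simp: poly_le_iff)
  have "(\<lambda>z. p z * q z) = (\<lambda>z. \<Sum>i\<in>exponents m. \<Sum>j\<in>exponents n.
      (c i * d j) * monom (\<lambda>l. fst i l + fst j l) (snd i + snd j) z)"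
    unfolding p q sum_product by (simp add: monom_mult[symmetric] mult_ac)
  also have "\<dots> \<in> poly_le (m + n)"
  proof (intro poly_le_sum poly_le_scale)
    fix i j :: "('a \<Rightarrow> nat) \<times> nat" assume "i \<in> exponents m" "j \<in> exponents n"
    then have "(\<lambda>l. fst i l + fst j l, snd i + snd j) \<in> exponents (m + n)"
      by (auto simp: exponents_def sum.distrib)
    from monom_in_poly_le[OF this]
    show "monom (\<lambda>l. fst i l + fst j l) (snd i + snd j) \<in> poly_le (m + n)" by simp
  qed
  finally show ?thesis .
qed

lemma monom_reflect: "monom \<alpha> k (reflect z) = (- 1) ^ k * monom \<alpha> k z"
  by (simp add: monom_def power_minus[of "snd z"])

lemma poly_le_reflect:
  assumes "p \<in> poly_le n"
  shows "(\<lambda>z. p (reflect z)) \<in> poly_le n"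
proof -
  obtain c where p: "p = (\<lambda>z. \<Sum>i\<in>exponents n. c i * monom (fst i) (snd i) z)"
    using assms by (auto simp: poly_le_iff)
  show ?thesis
    unfolding p by (simp add: monom_reflect) (intro poly_le_sum poly_le_scale monom_in_poly_le)
qed

lemma continuous_on_poly_le:
  assumes "p \<in> poly_le n"
  shows "continuous_on S p"
proof -
  obtain c where p: "p = (\<lambda>z. \<Sum>i\<in>exponents n. c i * monom (fst i) (snd i) z)"
    using assms by (auto simp: poly_le_iff)
  show ?thesis
    unfolding p monom_def by (intro continuous_intros)
qed

definition even_poly :: "nat \<Rightarrow> ((real^'d::finite) \<times> real \<Rightarrow> real) set" where
  "even_poly n = {p \<in> poly_le n. \<forall>x t. p (x, - t) = p (x, t)}"

lemma even_poly_iff: "p \<in> even_poly n \<longleftrightarrow> p \<in> poly_le n \<and> (\<forall>z. p (reflect z) = p z)"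
  by (auto simp: even_poly_def reflect_def)

lemma even_poly_imp_poly_le: "p \<in> even_poly n \<Longrightarrow> p \<in> poly_le n"
  by (simp add: even_poly_iff)

lemma even_poly_reflect: "p \<in> even_poly n \<Longrightarrow> p (reflect z) = p z"
  unfolding even_poly_iff by blast

lemma even_poly_add: "p \<in> even_poly n \<Longrightarrow> q \<in> even_poly n \<Longrightarrow> (\<lambda>z. p z + q z) \<in> even_poly n"
  by (simp add: even_poly_iff poly_le_add)

lemma even_poly_scale: "p \<in> even_poly n \<Longrightarrow> (\<lambda>z. k * p z) \<in> even_poly n"
  by (simp add: even_poly_iff poly_le_scale)

lemma even_poly_mono: "m \<le> n \<Longrightarrow> even_poly m \<subseteq> even_poly n"
  using poly_le_mono[of m n] by (auto simp: even_poly_iff)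

lemma symmetrise_in_even_poly: "p \<in> poly_le n \<Longrightarrow> (\<lambda>z. p z + p (reflect z)) \<in> even_poly n"
  by (simp add: even_poly_iff poly_le_add poly_le_reflect)

text \<open>Averaging a representation with its reflection avoids comparing coefficients. The
  generators with odd exponent of t are 0, so the family is dependent, which the projection onto a
  finite span tolerates.\<close>

lemma even_poly_span:
  assumes "p \<in> even_poly n"
  shows "\<exists>c. p = (\<lambda>z. \<Sum>i\<in>exponents n. c i * (monom (fst i) (snd i) z + monom (fst i) (snd i) (reflect z)))"
proof -
  obtain c where p: "p = (\<lambda>z. \<Sum>i\<in>exponents n. c i * monom (fst i) (snd i) z)"
    using assms by (auto simp: poly_le_iff even_poly_iff)
  have "p z = (\<Sum>i\<in>exponents n. c i / 2 * (monom (fst i) (snd i) z + monom (fst i) (snd i) (reflect z)))" for z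
  proof -
    have "p z = (p z + p (reflect z)) / 2"
      by (simp add: even_poly_reflect[OF assms])
    also have "\<dots> = (\<Sum>i\<in>exponents n. c i / 2 * (monom (fst i) (snd i) z + monom (fst i) (snd i) (reflect z)))"
      unfolding p by (simp only: sum.distrib[symmetric] sum_divide_distrib) (simp add: field_simps)
    finally show ?thesis .
  qed
  then show ?thesis by (intro exI[of _ "\<lambda>i. c i / 2"] ext)
qed

lemma even_poly_mult:
  "p \<in> even_poly m \<Longrightarrow> q \<in> even_poly n \<Longrightarrow> (\<lambda>z. p z * q z) \<in> even_poly (m + n)"
  by (simp add: even_poly_iff poly_le_mult)

lemma monom_in_even_poly:
  assumes "even k"
  shows "monom \<alpha> k \<in> even_poly ((\<Sum>i\<in>UNIV. \<alpha> i) + k)"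
  using assms monom_in_poly_le[of "(\<alpha>, k)"] by (simp add: even_poly_iff monom_reflect exponents_def)

lemma const_in_even_poly: "(\<lambda>_. k) \<in> even_poly 0"
  using even_poly_scale[OF monom_in_even_poly[of 0 "\<lambda>_. 0"], of k] by (simp add: monom_def)

text \<open>The even monomials \<open>x\<^sub>i\<close> and \<open>t\<^sup>2\<close> separate points as long as \<open>t \<ge> 0\<close>.\<close>
lemma even_poly_separates:
  fixes y z :: "(real^'d::finite) \<times> real"
  assumes "0 \<le> snd y" "0 \<le> snd z" "y \<noteq> z"
  shows "\<exists>n. \<exists>p\<in>even_poly n. p y \<noteq> p z"
proof (cases "fst y = fst z")
  case True
  then have "(snd y)\<^sup>2 \<noteq> (snd z)\<^sup>2"
    using assms by (auto simp: prod_eq_iff)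
  then have "monom (\<lambda>_. 0) 2 y \<noteq> monom (\<lambda>_. 0) 2 z"
    by (simp add: monom_def)
  then show ?thesis using monom_in_even_poly[of 2 "\<lambda>_::'d. 0"] by auto
next
  case False
  then obtain i where i: "fst y $ i \<noteq> fst z $ i" by (auto simp: vec_eq_iff)
  define \<alpha> where "\<alpha> j = (if j = i then 1 else 0 :: nat)" for j :: 'd
  have "monom \<alpha> 0 w = fst w $ i" for w
  proof -
    have "(\<Prod>j\<in>UNIV. fst w $ j ^ \<alpha> j) = (\<Prod>j\<in>UNIV. if j = i then fst w $ j else 1)"
      by (intro prod.cong) (auto simp: \<alpha>_def)
    then show ?thesis by (simp add: monom_def)
  qed
  then have "monom \<alpha> 0 y \<noteq> monom \<alpha> 0 z" using i by simp
  then show ?thesis using monom_in_even_poly[of 0 \<alpha>] by auto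
qed

section \<open>Convergence of the expansion on the half domain\<close>

theorem theorem4p8:
  fixes f :: "(real^'d::finite) \<times> real \<Rightarrow> real"
    and a b c \<beta> \<gamma> :: real
  assumes "0 \<le> a" and "a < b" and "0 \<le> c" and "0 \<le> \<beta>" and "\<gamma> > -1"
    and "f \<in> borel_measurable (wmeas \<beta> \<gamma> a b c (domL a b c))"
    and "integrable (wmeas \<beta> \<gamma> a b c (domL a b c)) (\<lambda>z. (f z)\<^sup>2)"
  shows "(\<lambda>N. integral\<^sup>L (wmeas \<beta> \<gamma> a b c (domL a b c))
            (\<lambda>z. (f z - (\<Sum>n<N. projE \<beta> \<gamma> a b c n f z))\<^sup>2)) \<longlonglongrightarrow> 0"
proof -
  define M :: "((real^'d) \<times> real) measure" where "M = wmeas \<beta> \<gamma> a b c (domL a b c)"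
  have fin: "finite_measure M"
    unfolding M_def using assms(1-5) by (rule finite_measure_wmeas_domL)
  have sets: "sets M = sets borel"
    by (simp add: M_def wmeas_def)
  have ae: "AE z in M. z \<in> domL a b c"
  proof -
    have "(\<lambda>z::(real^'d) \<times> real. ennreal (indicator (domL a b c) z * wt \<beta> \<gamma> a b c z)) \<in> borel_measurable borel"
      using measurable_indicator_wt by measurable
    then show ?thesis
      unfolding M_def wmeas_def by (subst AE_density) (auto simp: indicator_def)
  qed
  have sq: "square_integrable M p" if "continuous_on UNIV p" for p
    using fin sets compact_domL ae that by (rule square_integrable_continuous)
  have sqP: "square_integrable M p" if "p \<in> poly_le n" for p n
    using that by (intro sq continuous_on_poly_le)
  have f: "square_integrable M f"
    using assms(6,7) by (simp add: square_integrable_def M_def)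
  interpret L2_filtration M even_poly
  proof
    fix p q :: "(real^'d) \<times> real \<Rightarrow> real" and m n :: nat and k :: real
    show "p \<in> even_poly n \<Longrightarrow> square_integrable M p"
      by (auto simp: even_poly_iff intro: sqP)
    show "p \<in> even_poly n \<Longrightarrow> q \<in> even_poly n \<Longrightarrow> (\<lambda>z. p z + q z) \<in> even_poly n"
      by (rule even_poly_add)
    show "p \<in> even_poly n \<Longrightarrow> (\<lambda>z. k * p z) \<in> even_poly n"
      by (rule even_poly_scale)
    show "m \<le> n \<Longrightarrow> even_poly m \<subseteq> (even_poly n :: ((real^'d) \<times> real \<Rightarrow> real) set)"
      by (rule even_poly_mono)
  next
    fix h :: "(real^'d) \<times> real \<Rightarrow> real" and n :: nat
    assume h: "square_integrable M h"
    define e where "e i z = monom (fst i) (snd i) z + monom (fst i) (snd i) (reflect z)"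
      for i :: "('d \<Rightarrow> nat) \<times> nat" and z
    have e: "e i \<in> even_poly n" if "i \<in> exponents n" for i
      unfolding e_def[abs_def] using monom_in_poly_le[OF that] by (rule symmetrise_in_even_poly)
    have sq_e: "square_integrable M (e i)" if "i \<in> exponents n" for i
      using e[OF that] by (auto simp: even_poly_iff intro: sqP)
    obtain k where k: "\<And>i. i \<in> exponents n \<Longrightarrow>
        (\<integral>z. (h z - (\<Sum>j\<in>exponents n. k j * e j z)) * e i z \<partial>M) = 0"
      using exists_projection_finite_span[of "exponents n" M e h, OF finite_exponents sq_e h] by blast
    define g where "g z = (\<Sum>j\<in>exponents n. k j * e j z)" for z
    have "g \<in> even_poly n"
      unfolding g_def[abs_def] using e
      by (auto simp: even_poly_iff intro!: poly_le_sum poly_le_scale)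
    moreover have "(\<integral>z. (h z - g z) * q z \<partial>M) = 0" if qe: "q \<in> even_poly n" for q
    proof -
      obtain d where q: "q = (\<lambda>z. \<Sum>i\<in>exponents n. d i * e i z)"
        using even_poly_span[OF qe] unfolding e_def by blast
      have "square_integrable M (\<lambda>z. h z - g z)"
        using h \<open>g \<in> even_poly n\<close> by (auto simp: even_poly_iff intro: sqP square_integrable_diff)
      then have int: "integrable M (\<lambda>z. (h z - g z) * e i z)" if "i \<in> exponents n" for i
        using sq_e[OF that] by (rule square_integrable_mult_integrable)
      have "(\<integral>z. (h z - g z) * q z \<partial>M) = (\<integral>z. (\<Sum>i\<in>exponents n. d i * ((h z - g z) * e i z)) \<partial>M)"
        by (simp add: q sum_distrib_left mult.left_commute)
      also have "\<dots> = (\<Sum>i\<in>exponents n. d i * (\<integral>z. (h z - g z) * e i z \<partial>M))"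
        using int by (subst Bochner_Integration.integral_sum) auto
      also have "\<dots> = 0"
        using k by (simp add: g_def)
      finally show ?thesis .
    qed
    ultimately show "\<exists>p\<in>even_poly n. \<forall>q\<in>even_poly n. (\<integral>z. (h z - p z) * q z \<partial>M) = 0"
      by blast
  qed
  \<comment> \<open>\<open>VE\<close> tests on the full domain against all polynomials,
    \<open>W\<close> on the half domain against even ones. For even \<open>p\<close>, folding
    replaces \<open>q\<close> by \<open>q + q \<circ> reflect\<close>: this is \<open>2 * q\<close>
    when \<open>q\<close> is even, and in general an even polynomial of no larger degree
    bound.\<close>
  have VE: "VE \<beta> \<gamma> a b c n = W n" for n
  proof -
    have sym: "integral\<^sup>L (wmeas \<beta> \<gamma> a b c (domX a b c)) (\<lambda>z. p z * q z) =
        (\<integral>z. p z * (q z + q (reflect z)) \<partial>M)" if p: "p \<in> even_poly n" and q: "q \<in> poly_le m" for p q m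
    proof -
      have pP: "p \<in> poly_le n" and pr: "p (reflect z) = p z" for z
        using p by (auto intro: even_poly_imp_poly_le even_poly_reflect)
      have "integral\<^sup>L (wmeas \<beta> \<gamma> a b c (domX a b c)) (\<lambda>z. p z * q z) =
          (\<integral>z. p z * q z + p (reflect z) * q (reflect z) \<partial>M)"
        unfolding M_def
      proof (rule integral_wmeas_domX)
        show "(\<lambda>z. p z * q z) \<in> borel_measurable borel"
          using pP q by (intro borel_measurable_continuous_onI continuous_intros continuous_on_poly_le)
        show "integrable (wmeas \<beta> \<gamma> a b c (domL a b c)) (\<lambda>z. p z * q z)"
          using square_integrable_mult_integrable[OF sqP[OF pP] sqP[OF q]] by (simp add: M_def)
        show "integrable (wmeas \<beta> \<gamma> a b c (domL a b c)) (\<lambda>z. p (reflect z) * q (reflect z))"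
          using square_integrable_mult_integrable[OF sqP[OF pP] sqP[OF poly_le_reflect[OF q]]]
          by (simp add: M_def pr)
      qed
      then show ?thesis by (simp add: pr distrib_left)
    qed
    show ?thesis
    proof (intro set_eqI iffI)
      fix p :: "(real^'d) \<times> real \<Rightarrow> real" assume p: "p \<in> VE \<beta> \<gamma> a b c n"
      then have pe: "p \<in> even_poly n" by (simp add: VE_def even_poly_def)
      have "(\<integral>z. p z * q z \<partial>M) = 0" if "m < n" "q \<in> even_poly m" for m q
      proof -
        have q: "q \<in> poly_le m" and qr: "q (reflect z) = q z" for z
          using that by (auto intro: even_poly_imp_poly_le even_poly_reflect)
        have "(\<integral>z. p z * (q z + q (reflect z)) \<partial>M) = 0"
          using p that(1) q sym[OF pe q] by (auto simp: VE_def)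
        then have "(\<integral>z. 2 * (p z * q z) \<partial>M) = 0"
          by (simp add: qr mult_2[symmetric] mult.left_commute)
        then show ?thesis by simp
      qed
      then show "p \<in> W n" using pe by (simp add: W_def)
    next
      fix p assume p: "p \<in> W n"
      then have pe: "p \<in> even_poly n" by (simp add: W_def)
      have "integral\<^sup>L (wmeas \<beta> \<gamma> a b c (domX a b c)) (\<lambda>z. p z * q z) = 0"
        if "m < n" "q \<in> poly_le m" for m q
        using p that symmetrise_in_even_poly[OF that(2)] sym[OF pe that(2)] by (auto simp: W_def)
      then show "p \<in> VE \<beta> \<gamma> a b c n" using pe by (simp add: VE_def even_poly_def)
    qed
  qed
  define g where "g n = projE \<beta> \<gamma> a b c n f" for n
  have g: "g n \<in> W n \<and> (\<forall>p\<in>W n. (\<integral>z. (f z - g n z) * p z \<partial>M) = 0)" for n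
  proof -
    \<comment> \<open>Existence of some projection guarantees that the function chosen by
      \<open>SOME\<close> in \<open>projE\<close> has the required properties.\<close>
    have "\<exists>g. g \<in> W n \<and> (\<forall>p\<in>W n. (\<integral>z. (f z - g z) * p z \<partial>M) = 0)"
      using projection_W[OF f, of n] by (simp only: Bex_def)
    from someI_ex[OF this] show ?thesis
      unfolding g_def projE_def VE M_def .
  qed
  \<comment> \<open>The degree is quantified away because an algebra is needed, and products raise
    the degree.\<close>
  have approx: "L2_approximable M (\<lambda>p. \<exists>n. p \<in> even_poly n) f"
  proof (rule L2_approximable_Stone_Weierstrass[OF fin sets compact_domL ae])
    fix p q :: "(real^'d) \<times> real \<Rightarrow> real"
    assume "\<exists>n. p \<in> even_poly n" "\<exists>n. q \<in> even_poly n"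
    then obtain m n where p: "p \<in> even_poly m" and q: "q \<in> even_poly n" by blast
    then have "p \<in> even_poly (max m n)" "q \<in> even_poly (max m n)"
      using even_poly_mono[of m "max m n"] even_poly_mono[of n "max m n"] by auto
    then show "\<exists>n. (\<lambda>z. p z + q z) \<in> even_poly n"
      using even_poly_add by blast
    show "\<exists>n. (\<lambda>z. p z * q z) \<in> even_poly n"
      using even_poly_mult[OF p q] by blast
  next
    fix y z :: "(real^'d) \<times> real" assume "y \<in> domL a b c" "z \<in> domL a b c" "y \<noteq> z"
    then show "\<exists>p. (\<exists>n. p \<in> even_poly n) \<and> p y \<noteq> p z"
      using even_poly_separates[of y z] by (auto simp: domL_def)
  qed (use const_in_even_poly f in \<open>auto simp: even_poly_iff intro: continuous_on_poly_le\<close>)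
  have "(\<lambda>N. \<integral>z. (f z - (\<Sum>n<N. g n z))\<^sup>2 \<partial>M) \<longlonglongrightarrow> 0"
  proof (rule orthogonal_expansion[OF f])
    show "\<exists>n. \<exists>p\<in>even_poly n. (\<integral>z. (f z - p z)\<^sup>2 \<partial>M) < e" if "0 < e" for e
      using approx that unfolding L2_approximable_def by blast
  qed (use g in auto)
  then show ?thesis by (simp add: g_def M_def)
qed

end
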